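(* Let $E:\{0,1\}^k\times\{0,1\}^d\to\{0,1\}^d$ be a PRP generator, i.e. $E_s=E(s,\cdot)$ is a permutation of $\{0,1\}^d$ for each $s$. Let $F$ be the PRF generator obtained by the xor construction: $F_{(s_1,s_2)}(x)=E_{s_1}(x)\oplus E_{s_2}(x)$ with keys $(s_1,s_2)\in\{0,1\}^k\times\{0,1\}^k$. Then for every $m<2^d$, \[ \mathrm{Adv}_F^{\mathrm{PRF}}(m)\le 2\,\mathrm{Adv}_E^{\mathrm{PRP}}(m)+O(m/2^{3d/2}), \] with an absolute implied constant.
   Context: $\oplus$ is bitwise xor, i.e. addition in $\mathbf{F}_2^d\cong\{0,1\}^d$. A distinguisher $A$ is a probabilistic algorithm that is given oracle access to a function $g:\{0,1\}^d\to\{0,1\}^d$, may query values $g(x)$ adaptively (query points may depend on previous answers), and outputs $A(g)\in\{0,1\}$; no computational restriction is imposed other than the number of queries. For a keyed family $F$ with key space $K$, $\mathrm{Adv}_F^{\mathrm{PRF}}(A)=|\mathbb P(A(F_s)=1)-\mathbb P(A(f)=1)|$ with $s$ uniform in $K$ and $f$ a uniformly random function $\{0,1\}^d\to\{0,1\}^d$; $\mathrm{Adv}_E^{\mathrm{PRP}}(A)=|\mathbb P(A(E_s)=1)-\mathbb P(A(\pi)=1)|$ with $s$ uniform in $\{0,1\}^k$ and $\pi$ a uniformly random permutation of $\{0,1\}^d$. Finally $\mathrm{Adv}^{\mathrm{PRF}}_F(m)$ (resp. $\mathrm{Adv}^{\mathrm{PRP}}_E(m)$) is the maximum of $\mathrm{Adv}^{\mathrm{PRF}}_F(A)$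 (resp. $\mathrm{Adv}^{\mathrm{PRP}}_E(A)$) over all distinguishers $A$ making at most $m$ queries. *)

theory Defs
  imports "HOL-Probability.Probability"
begin

text \<open>Bit strings in {0,1}^d are encoded as natural numbers below 2^d;
  bitwise xor is Bit_Operations.xor on nat.  Functions {0,1}^d -> {0,1}^d are
  represented as nat => nat (only their values on {..<2^d} matter).\<close>

datatype strat = Out bool | Query nat "nat \<Rightarrow> strat"

primrec run_strat :: "(nat \<Rightarrow> nat) \<Rightarrow> strat \<Rightarrow> bool" where
  "run_strat g (Out b) = b"
| "run_strat g (Query x c) = run_strat g (c (g x))"

inductive queries_le :: "nat \<Rightarrow> nat \<Rightarrow> strat \<Rightarrow> bool" where
  qout: "queries_le d n (Out b)"
| qquery: "x < 2 ^ d \<Longrightarrow> (\<And>y. queries_le d n (c y)) \<Longrightarrow> queries_le d (Suc n) (Query x c)"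

text \<open>A probabilistic distinguisher is a distribution over deterministic
  strategies (its random coins fixed in advance).\<close>
definition is_distinguisher :: "nat \<Rightarrow> nat \<Rightarrow> strat pmf \<Rightarrow> bool" where
  "is_distinguisher d m A \<longleftrightarrow> (\<forall>S\<in>set_pmf A. queries_le d m S)"

definition accept_prob :: "strat pmf \<Rightarrow> (nat \<Rightarrow> nat) pmf \<Rightarrow> real" where
  "accept_prob A G = measure_pmf.prob (bind_pmf A (\<lambda>S. map_pmf (\<lambda>g. run_strat g S) G)) {True}"

definition adv_with :: "strat pmf \<Rightarrow> (nat \<Rightarrow> nat) pmf \<Rightarrow> (nat \<Rightarrow> nat) pmf \<Rightarrow> real" where
  "adv_with A G0 G1 = \<bar>accept_prob A G0 - accept_prob A G1\<bar>"

definition adv :: "nat \<Rightarrow> nat \<Rightarrow> (nat \<Rightarrow> nat) pmf \<Rightarrow> (nat \<Rightarrow> nat) pmf \<Rightarrow> real" where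
  "adv d m G0 G1 = (SUP A \<in> {A. is_distinguisher d m A}. adv_with A G0 G1)"

definition rand_fun :: "nat \<Rightarrow> (nat \<Rightarrow> nat) pmf" where
  "rand_fun d = pmf_of_set (PiE {..<(2::nat)^d} (\<lambda>_. {..<(2::nat)^d}))"

definition rand_perm :: "nat \<Rightarrow> (nat \<Rightarrow> nat) pmf" where
  "rand_perm d = pmf_of_set {p \<in> PiE {..<(2::nat)^d} (\<lambda>_. {..<(2::nat)^d}).
                              bij_betw p {..<(2::nat)^d} {..<(2::nat)^d}}"

definition is_prp_gen :: "nat \<Rightarrow> nat \<Rightarrow> (nat \<Rightarrow> nat \<Rightarrow> nat) \<Rightarrow> bool" where
  "is_prp_gen k d E \<longleftrightarrow> (\<forall>s < 2 ^ k. bij_betw (E s) {..<(2::nat)^d} {..<(2::nat)^d})"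

definition keyed_E :: "nat \<Rightarrow> (nat \<Rightarrow> nat \<Rightarrow> nat) \<Rightarrow> (nat \<Rightarrow> nat) pmf" where
  "keyed_E k E = map_pmf E (pmf_of_set {..<(2::nat)^k})"

definition keyed_xor :: "nat \<Rightarrow> (nat \<Rightarrow> nat \<Rightarrow> nat) \<Rightarrow> (nat \<Rightarrow> nat) pmf" where
  "keyed_xor k E = map_pmf (\<lambda>(s1, s2). \<lambda>x. xor (E s1 x) (E s2 x))
      (pmf_of_set ({..<(2::nat)^k} \<times> {..<(2::nat)^k}))"

definition adv_prp :: "nat \<Rightarrow> nat \<Rightarrow> (nat \<Rightarrow> nat \<Rightarrow> nat) \<Rightarrow> nat \<Rightarrow> real" where
  "adv_prp k d E m = adv d m (keyed_E k E) (rand_perm d)"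

definition adv_prf_xor :: "nat \<Rightarrow> nat \<Rightarrow> (nat \<Rightarrow> nat \<Rightarrow> nat) \<Rightarrow> nat \<Rightarrow> real" where
  "adv_prf_xor k d E m = adv d m (keyed_xor k E) (rand_fun d)"

end

theory Submission
  imports Defs "HOL-Combinatorics.Multiset_Permutations" "HOL-Real_Asymp.Real_Asymp"
begin

text \<open>
  By a hybrid argument it suffices to distinguish the xor of two independent random permutations of
  $G = \mathbf{F}_2^d$ from a random function; put $N = 2^d$. Both are exchangeable in the query
  points, so adaptivity does not help, and Cauchy--Schwarz together with Parseval bounds the
  advantage by $\sqrt{L_m}$, where $L_m = \sum_{a \ne 0} \hat\mu(a)^4$ runs over the nontrivial
  characters of $G^m$ and $\hat\mu$ is the Fourier transform of the law of a random permutation.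
  Characters supported on one point do not contribute, so averaging over the omitted point gives
  $L_m \le O(m^2/N^2) \, L_{N-1}$ and only $L_{N-1} = O(1/N)$ is left.

  Up to normalisation $\hat\mu(a)$ is the coefficient of $\prod_g z_g^{c_g}$ in
  $\prod_x \sum_g z_g \chi_g(x)$, where $c_g$ is the multiplicity of $g$ in $a$; averaging over
  circles of radius $\sqrt{c_g/N}$ and applying AM-GM and orthogonality yields
  $\hat\mu(a)^2 \le (\prod_g c_g!/N!)^2 N^N / \prod_g c_g^{c_g}$. Hence all characters with
  multiplicities $c$ contribute at most $\prod_g \varphi(c_g) / \varphi(N)$ with
  $\varphi(c) = c!^3/c^{2c}$. After translating $a$ so that its most frequent value is $0$, the sum
  over $c$ is estimated according to $w = N - c_0$ by generating functions.
\<close>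

section \<open>Estimates for the weights\<close>

text \<open>The reduction stops at \<open>N - 1\<close> points because all \<open>N\<close> points
  are hopeless: the xor of all values of a permutation is fixed, so every constant character has
  coefficient 1 or -1 and would contribute 1 to the sum. For \<open>N - 1\<close> points the order
  1/N is forced by the characters with exactly two nonzero entries, both equal: each has coefficient
  -1/(N - 1), and there are about N^3/2 of them. Small \<open>w\<close> must therefore be estimated
  without polynomial loss. Counting all multisets with \<open>w\<close> nonzero elements would lose
  a factor \<open>N\<close>; it is regained because a nonzero coefficient forces the xor of all
  entries to be 0, so that \<open>w - 1\<close> of the elements determine the last one. The
  factorials cause a second difficulty: the generating function of the weights has radius of
  convergence 0. It is truncated at the largest possible multiplicity, and making 0 the most
  frequent value is what bounds this multiplicity by \<open>N - w\<close> when \<open>w\<close> is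
  large. The constants are crude; 700, 10000 and 7000 only have to fit the three ranges of
  \<open>w\<close> together.\<close>

definition phi :: "nat \<Rightarrow> real" where
  "phi c = fact c ^ 3 / (real c ^ c)\<^sup>2"

text \<open>The ratio in Stirling's formula, asymptotic to sqrt(2 pi c). It enters through its
  monotonicity and a linear upper bound.\<close>

definition st :: "nat \<Rightarrow> real" where
  "st c = fact c * exp (real c) / real c ^ c"

lemma pow_self_pos: "real c ^ c > 0"
  by (cases c) auto

lemma pow_self_neq_0 [simp]: "real c ^ c \<noteq> 0"
  using pow_self_pos[of c] by linarith

lemma st_pos: "st c > 0"
  unfolding st_def by (intro divide_pos_pos mult_pos_pos pow_self_pos) auto

lemma st_Suc: "st (Suc c) = fact c * exp (real c) * exp 1 / real (Suc c) ^ c"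
proof -
  have "exp (real (Suc c)) = exp 1 * exp (real c)" by (simp add: exp_add)
  then show ?thesis unfolding st_def fact_Suc power_Suc by (simp del: of_nat_Suc)
qed

text \<open>The ratio of consecutive values is e / (1 + 1/c)^c, which is at least 1.\<close>

lemma st_mono_Suc: "st c \<le> st (Suc c)"
proof (cases "c = 0")
  case False
  have "(1 + 1 / real c) ^ c \<le> exp 1"
    using exp_ge_one_plus_x_over_n_power_n[of c 1] False by simp
  then have "(real (Suc c) / real c) ^ c \<le> exp 1"
    using False by (simp add: field_simps)
  then have e: "real (Suc c) ^ c \<le> exp 1 * real c ^ c"
    using pow_self_pos[of c] by (simp add: power_divide field_simps)
  have "st c = fact c * exp (real c) * exp 1 / (exp 1 * real c ^ c)"
    by (simp add: st_def)
  also have "\<dots> \<le> fact c * exp (real c) * exp 1 / real (Suc c) ^ c"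
    by (intro divide_left_mono e mult_pos_pos pow_self_pos) auto
  finally show ?thesis unfolding st_Suc .
qed (simp add: st_def)

lemma st_mono: "a \<le> b \<Longrightarrow> st a \<le> st b"
  by (rule lift_Suc_mono_le[of st]) (rule st_mono_Suc)

text \<open>The quotient \<open>st n / n\<close> decreases from its value e at n = 1, because (1 -
  1/(n+1))^(n+1) <= 1/e.\<close>

lemma st_Suc_le: "st (Suc c) \<le> exp 1 * real (Suc c)"
proof (induction c)
  case 0
  then show ?case by (simp add: st_def)
next
  case (Suc c)
  define n where "n = Suc c"
  have n: "n > 0" by (simp add: n_def)
  have "(1 - 1 / real (Suc n)) ^ Suc n \<le> exp (- 1)"
    using exp_ge_one_minus_x_over_n_power_n[of 1 "Suc n"] by simp
  moreover have "1 - 1 / real (Suc n) = real n / real (Suc n)" by (simp add: field_simps)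
  ultimately have "real n ^ Suc n \<le> exp (- 1) * real (Suc n) ^ Suc n"
    by (simp only: power_divide) (simp add: divide_le_eq)
  then have e: "exp 1 * real n ^ Suc n \<le> real (Suc n) ^ Suc n"
    by (simp add: exp_minus field_simps)
  have "st (Suc n) = st n * (exp 1 * real n ^ n / real (Suc n) ^ n)"
    unfolding st_Suc unfolding st_def using n by simp
  also have "exp 1 * real n ^ n / real (Suc n) ^ n \<le> real (Suc n) / real n"
    using e n by (simp add: field_simps)
  then have "st n * (exp 1 * real n ^ n / real (Suc n) ^ n) \<le> st n * (real (Suc n) / real n)"
    using st_pos[of n] by (intro mult_left_mono) auto
  also have "\<dots> \<le> (exp 1 * real n) * (real (Suc n) / real n)"
    using Suc.IH n by (intro mult_right_mono) (auto simp: n_def)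
  also have "\<dots> = exp 1 * real (Suc n)" using n by simp
  finally show ?case by (simp add: n_def)
qed

lemma phi_st: "phi c = fact c * (st c)\<^sup>2 * exp (- 2 * real c)"
proof -
  have "exp (- 2 * real c) = 1 / (exp (real c))\<^sup>2"
    by (simp add: exp_minus exp_of_nat2_mult[symmetric] power2_eq_square exp_add[symmetric] divide_inverse)
  then show ?thesis
    unfolding phi_def st_def by (simp add: power2_eq_square power3_eq_cube field_simps)
qed

lemma phi_pos: "phi c > 0"
  unfolding phi_st using st_pos[of c] by simp

text \<open>\<open>phi c\<close> with the factor exp(-2c) split off and \<open>st c\<close> replaced
  by its bound e c; 8 bounds e^2. Over a whole multiset the split-off factors multiply to
  exp(-2w).\<close>

definition wt :: "nat \<Rightarrow> real" where
  "wt c = (if c = 0 then 1 else 8 * (real c)\<^sup>2 * fact c)"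

lemma wt_pos: "wt c > 0"
  by (simp add: wt_def)

lemma exp_1_sq_le: "(exp 1 :: real)\<^sup>2 \<le> 8"
proof -
  have "(exp 1 :: real) < 2.8" using e_less_272 by simp
  then have "(exp 1 :: real)\<^sup>2 \<le> 2.8\<^sup>2" by (intro power_mono) auto
  then show ?thesis by (simp add: power2_eq_square)
qed

lemma phi_le_wt: "phi c \<le> wt c * exp (- 2 * real c)"
proof (cases c)
  case (Suc b)
  have "(st c)\<^sup>2 \<le> (exp 1 * real c)\<^sup>2"
    using st_Suc_le[of b] st_pos[of c] Suc by (intro power_mono) auto
  also have "\<dots> \<le> 8 * (real c)\<^sup>2"
    unfolding power_mult_distrib by (intro mult_right_mono exp_1_sq_le) auto
  finally have "fact c * (st c)\<^sup>2 \<le> fact c * (8 * (real c)\<^sup>2)" by (intro mult_left_mono) auto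
  then show ?thesis unfolding phi_st wt_def using Suc by (intro mult_right_mono) (auto simp: mult_ac)
qed (simp add: phi_def wt_def)

lemma wt_Suc_le: "wt (Suc c) \<le> 8 * real (Suc c) * wt c"
proof (cases "c = 0")
  case False
  have "real (Suc c) \<le> 2 * real c" using False by simp
  then have "(real (Suc c))\<^sup>2 \<le> (2 * real c)\<^sup>2" by (intro power_mono) auto
  moreover have "(2 * real c)\<^sup>2 = 4 * (real c)\<^sup>2" by (simp add: power_mult_distrib)
  ultimately have "(real (Suc c))\<^sup>2 \<le> 8 * (real c)\<^sup>2"
    using zero_le_power2[of "real c"] by linarith
  then have "8 * real (Suc c) * fact c * (real (Suc c))\<^sup>2 \<le> 8 * real (Suc c) * fact c * (8 * (real c)\<^sup>2)"
    by (intro mult_left_mono) auto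
  then show ?thesis using False by (simp add: wt_def mult_ac del: of_nat_Suc)
qed (simp add: wt_def)

text \<open>Write \<open>phi c\<close> as (st c)^3 c^c exp(-3c); the cube of
  \<open>st t / st n\<close> is at most 1 by monotonicity and is dropped.\<close>

lemma phi_ratio_le:
  assumes "t \<le> n"
  shows "phi t / phi n \<le> exp (3 * (real n - real t)) * real t ^ t / real n ^ n"
proof -
  have st: "st t / st n \<le> 1" "0 \<le> st t / st n"
    using st_mono[OF assms] st_pos[of t] st_pos[of n] by auto
  have f: "fact c = st c * real c ^ c * exp (- real c)" for c
    by (cases "c = 0") (auto simp: st_def exp_minus field_simps)
  have "phi t / phi n = (st t / st n) ^ 3 * (exp (3 * (real n - real t)) * real t ^ t / real n ^ n)"
    unfolding phi_st f using st_pos[of n]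
    by (simp add: power2_eq_square power3_eq_cube exp_minus exp_diff right_diff_distrib exp_of_nat_mult[symmetric] field_simps exp_add[symmetric])
  also have "\<dots> \<le> 1 * (exp (3 * (real n - real t)) * real t ^ t / real n ^ n)"
    using st by (intro mult_right_mono power_le_one) auto
  finally show ?thesis by simp
qed

text \<open>Passing from c to c + 1 multiplies the left side by (c+1)/T <= 1, so the value at c = 4
  dominates. The start 4 is the first one for which T^2 times this value is O(1/T).\<close>

lemma fact_div_power_le:
  assumes "4 \<le> c" "c \<le> T"
  shows "fact c * (1 / real T) ^ (c - 1) \<le> 24 / real T ^ 3"
  using assms
proof (induction c rule: dec_induct)
  case base
  then show ?case by (simp add: power_divide fact_numeral)
next
  case (step c)
  have "fact (Suc c) * (1 / real T) ^ (Suc c - 1) = (real (Suc c) / real T) * (fact c * (1 / real T) ^ (c - 1))"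
    using step by (cases c) (auto simp: field_simps)
  also have "\<dots> \<le> 1 * (fact c * (1 / real T) ^ (c - 1))"
    using step by (intro mult_right_mono) auto
  also have "\<dots> \<le> 24 / real T ^ 3" using step by simp
  finally show ?case .
qed

text \<open>A bound linear in \<open>z\<close> survives the factorial growth of \<open>wt\<close>
  because the sum stops at \<open>T\<close> and z <= 1/T. After division by 8z the terms c = 1, 2, 3
  are at most 1, 8, 54 up to an error 24/T, and each later one is at most 24/T, which gives 63 + 24
  = 87 in total; 8 * 87 is below 700.\<close>

lemma wt_gen_le:
  assumes T: "T \<ge> 1" and z: "0 \<le> z" "z * real T \<le> 1"
  shows "(\<Sum>c\<le>T. wt c * z ^ c) \<le> 1 + 700 * z"
proof -
  have zT: "z \<le> 1 / real T" using z T by (simp add: field_simps)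
  have each: "(real c)\<^sup>2 * fact c * z ^ (c - 1) \<le> (if c = 1 then 1 else if c = 2 then 8 else if c = 3 then 54 else 0) + 24 / real T"
    if c: "c \<in> {1..T}" for c
  proof -
    have T0: "1 / real T \<le> 1" using T by simp
    have le: "z ^ (c - 1) \<le> (1 / real T) ^ (c - 1)" using z zT by (intro power_mono) auto
    have pos: "0 \<le> 24 / real T" by simp
    have le1: "z ^ (c - 1) \<le> 1" using le T0 by (meson order_trans power_le_one zero_le_divide_1_iff of_nat_0_le_iff)
    consider "c = 1" | "c = 2" | "c = 3" | "c \<ge> 4" using c by fastforce
    then show ?thesis
    proof cases
      case 4
      have "(real c)\<^sup>2 * fact c * z ^ (c - 1) \<le> (real c)\<^sup>2 * (fact c * (1 / real T) ^ (c - 1))"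
        unfolding mult.assoc by (intro mult_left_mono le) auto
      also have "\<dots> \<le> (real T)\<^sup>2 * (24 / real T ^ 3)"
        using c 4 by (intro mult_mono fact_div_power_le power_mono) auto
      also have "\<dots> = 24 / real T" using T by (simp add: power2_eq_square power3_eq_cube)
      finally show ?thesis using 4 by simp
    next
      case 2
      then have "(real c)\<^sup>2 * fact c * z ^ (c - 1) = 8 * z" by simp
      moreover have "z \<le> 1" using le1 2 by simp
      then have "8 * z \<le> 8 + 24 / real T" using pos by linarith
      ultimately show ?thesis using 2 by simp
    next
      case 3
      then have "(real c)\<^sup>2 * fact c * z ^ (c - 1) = 54 * z\<^sup>2" by (simp add: fact_numeral)
      moreover have "z\<^sup>2 \<le> 1" using le1 3 by simp
      then have "54 * z\<^sup>2 \<le> 54 + 24 / real T" using pos by linarith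
      ultimately show ?thesis using 3 by (simp add: fact_numeral)
    qed (use pos in simp)
  qed
  have "(\<Sum>c\<in>{1..T}. (real c)\<^sup>2 * fact c * z ^ (c - 1))
      \<le> (\<Sum>c\<in>{1..T}. (if c = 1 then 1 else if c = 2 then 8 else if c = 3 then 54 else 0) + 24 / real T)"
    by (intro sum_mono each)
  also have "\<dots> \<le> 63 + 24"
  proof -
    have "(\<Sum>c\<in>{1..T}. (if c = 1 then 1 else if c = 2 then 8 else if c = 3 then 54 else 0 :: real))
        = (\<Sum>c\<in>{1..T} \<inter> {1, 2, 3}. (if c = 1 then 1 else if c = 2 then 8 else if c = 3 then 54 else 0 :: real))"
      by (rule sum.mono_neutral_right) auto
    also have "\<dots> \<le> (\<Sum>c\<in>{1, 2, 3::nat}. (if c = 1 then 1 else if c = 2 then 8 else if c = 3 then 54 else 0 :: real))"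
      by (rule sum_mono2) auto
    also have "\<dots> = 63" by simp
    finally show ?thesis using T by (simp add: sum.distrib)
  qed
  finally have b: "(\<Sum>c\<in>{1..T}. (real c)\<^sup>2 * fact c * z ^ (c - 1)) \<le> 87" by simp
  have "{..T} = insert 0 {1..T}" by auto
  then have "(\<Sum>c\<le>T. wt c * z ^ c) = 1 + (\<Sum>c\<in>{1..T}. wt c * z ^ c)"
    by (simp add: wt_def)
  also have "(\<Sum>c\<in>{1..T}. wt c * z ^ c) = (\<Sum>c\<in>{1..T}. 8 * z * ((real c)\<^sup>2 * fact c * z ^ (c - 1)))"
  proof (intro sum.cong refl)
    fix c assume "c \<in> {1..T}"
    then obtain b where "c = Suc b" by (cases c) auto
    then show "wt c * z ^ c = 8 * z * ((real c)\<^sup>2 * fact c * z ^ (c - 1))" by (simp add: wt_def)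
  qed
  also have "\<dots> = 8 * z * (\<Sum>c\<in>{1..T}. (real c)\<^sup>2 * fact c * z ^ (c - 1))"
    by (simp add: sum_distrib_left)
  also have "\<dots> \<le> 8 * z * 87" using z b by (intro mult_left_mono) auto
  finally show ?thesis using z by simp
qed

section \<open>The three ranges of \<open>w\<close>\<close>

lemma power_4_geometric_bounded: "\<exists>K>0. \<forall>n. real n ^ 4 * (0.95::real) ^ n \<le> K"
proof -
  have "(\<lambda>n. real n ^ 4 * (0.95::real) ^ n) \<longlonglongrightarrow> 0" by real_asymp
  then have "Bseq (\<lambda>n. real n ^ 4 * (0.95::real) ^ n)" by (intro convergent_imp_Bseq convergentI)
  then obtain K where "K > 0" "\<forall>n. norm (real n ^ 4 * (0.95::real) ^ n) \<le> K" by (auto elim: BseqE)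
  then show ?thesis by (intro exI[of _ K]) auto
qed

lemma one_plus_power_le_exp: "0 \<le> x \<Longrightarrow> (1 + x) ^ n \<le> exp (real n * x)" for x :: real
proof -
  assume "0 \<le> x"
  then have "(1 + x) ^ n \<le> exp x ^ n" by (intro power_mono exp_ge_add_one_self) auto
  then show ?thesis by (simp add: exp_of_nat_mult)
qed

text \<open>With \<open>t\<close> elements equal to the most frequent one and \<open>w = n - t\<close> others, the argument \<open>z\<close> of
  the generating function is \<open>w / (10000 * n)\<close> for \<open>w\<close> of order at most \<open>sqrt n\<close>, then \<open>1 / w\<close> up to
  \<open>n / 2\<close>, and \<open>1 / t\<close> beyond.\<close>

lemma small_regime:
  fixes n w :: nat
  assumes w: "1 \<le> w" "w \<le> n" and wn: "real w ^ 2 \<le> 10000 * real n"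
  defines "z \<equiv> real w / (10000 * real n)" and "t \<equiv> n - w"
  shows "exp (real w) * real t ^ t / real n ^ n * (8 * real w * ((1 + 700 * z) ^ n / z ^ (w - 1)))
    \<le> 8 * (40000 * exp 2) ^ w / fact w / real n"
proof -
  have n0: "real n > 0" and w0: "real w > 0" using w by auto
  have z0: "z > 0" using n0 w0 by (simp add: z_def)
  have tn: "real t ^ t / real n ^ n \<le> 1 / real n ^ w"
  proof -
    have "real t ^ t \<le> real n ^ t" by (intro power_mono) (auto simp: t_def)
    moreover have "real n ^ n = real n ^ t * real n ^ w" using w by (simp add: t_def power_add[symmetric])
    ultimately show ?thesis using n0 by (simp add: field_simps)
  qed
  \<comment> \<open>Since 700 < 10000, this factor costs less than exp w.\<close>
  have "(1 + 700 * z) ^ n \<le> exp (real n * (700 * z))" using z0 by (intro one_plus_power_le_exp) simp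
  also have "real n * (700 * z) \<le> real w" using n0 w0 by (simp add: z_def)
  then have "exp (real n * (700 * z)) \<le> exp (real w)" by simp
  finally have e: "(1 + 700 * z) ^ n \<le> exp (real w)" .
  have zw: "1 / z ^ (w - 1) = (10000 * real n) ^ (w - 1) / real w ^ (w - 1)"
    using n0 w0 by (simp add: z_def power_divide)
  have "exp (real w) * real t ^ t / real n ^ n * (8 * real w * ((1 + 700 * z) ^ n / z ^ (w - 1)))
      = (exp (real w) * (8 * real w) * (1 / z ^ (w - 1))) * ((real t ^ t / real n ^ n) * (1 + 700 * z) ^ n)"
    by (simp add: mult_ac)
  also have "\<dots> \<le> (exp (real w) * (8 * real w) * (1 / z ^ (w - 1))) * ((1 / real n ^ w) * exp (real w))"
    using z0 by (intro mult_left_mono mult_mono tn e) auto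
  \<comment> \<open>Because the exponent of \<open>z\<close> is \<open>w - 1\<close>, only n^(w-1)
    stands against n^w, and a factor 1/n is left.\<close>
  also have "\<dots> = 8 * exp (real w) ^ 2 * 10000 ^ (w - 1) * real w ^ 2 / real w ^ w / real n"
  proof -
    obtain v where v: "w = Suc v" using w by (cases w) auto
    show ?thesis unfolding zw unfolding power_mult_distrib v using n0
      by (simp add: power2_eq_square field_simps del: of_nat_Suc)
  qed
  also have "\<dots> \<le> 8 * exp (real w) ^ 2 * 10000 ^ w * 4 ^ w / fact w / real n"
  proof -
    \<comment> \<open>All exponential losses go into the base 40000 exp 2 = 10000 * 4 * exp 2; what
      matters is \<open>fact w\<close> in the denominator, which makes the bound summable over
      \<open>w\<close>.\<close>
    have "w < 2 ^ w" by (rule less_exp)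
    then have "real w < 2 ^ w" by (metis of_nat_less_iff of_nat_numeral of_nat_power)
    then have "real w ^ 2 \<le> (2 ^ w)\<^sup>2" by (intro power_mono) auto
    also have "(2 ^ w)\<^sup>2 = (4::real) ^ w" by (simp add: power_mult[symmetric] power2_eq_square power_mult_distrib[symmetric])
    finally have w4: "real w ^ 2 \<le> 4 ^ w" .
    have f: "fact w \<le> real w ^ w" using fact_le_power[of w, where 'a = real] by simp
    have p: "(10000::real) ^ (w - 1) \<le> 10000 ^ w" by (intro power_increasing) auto
    show ?thesis using n0 w0
      by (intro divide_right_mono frac_le mult_mono w4 f p) auto
  qed
  also have "\<dots> = 8 * (40000 * exp 2) ^ w / fact w / real n"
  proof -
    have "exp (real w) ^ 2 = (exp 2 :: real) ^ w" by (simp add: exp_of_nat_mult[symmetric] exp_of_nat2_mult[symmetric] mult.commute)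
    moreover have "(10000::real) ^ w * 4 ^ w = 40000 ^ w"
      unfolding power_mult_distrib[symmetric] by simp
    ultimately show ?thesis by (simp add: power_mult_distrib)
  qed
  finally show ?thesis .
qed

text \<open>With x = w/n, the estimate (1-x)^t <= exp(-w + x w) cancels exp w up to exp(x w), and
  the whole is at most (x exp(x + 0.07))^w. The hypothesis on w^2 yields 0.07 = 700/10000; even at x
  = 1/2 the base stays below 0.95.\<close>

lemma medium_regime:
  fixes n w :: nat
  assumes w: "1 \<le> w" "2 * w \<le> n" and wn: "real w ^ 2 \<ge> 10000 * real n"
  defines "t \<equiv> n - w"
  shows "exp (real w) * real t ^ t / real n ^ n * ((1 + 700 * (1 / real w)) ^ n / (1 / real w) ^ w) \<le> 0.95 ^ w"
proof -
  have n0: "real n > 0" and w0: "real w > 0" using w by auto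
  define x where "x = real w / real n"
  have x: "0 < x" "x \<le> 1 / 2" using w n0 w0 by (auto simp: x_def field_simps)
  have tn: "real t = real n * (1 - x)" using w n0 by (simp add: t_def x_def field_simps of_nat_diff)
  have "(1 + 700 * (1 / real w)) ^ n \<le> exp (real n * (700 * (1 / real w)))"
    by (intro one_plus_power_le_exp) simp
  also have "real n * (700 * (1 / real w)) \<le> 0.07 * real w"
    using wn w0 by (simp add: field_simps power2_eq_square)
  then have "exp (real n * (700 * (1 / real w))) \<le> exp (0.07 * real w)" by simp
  finally have e: "(1 + 700 * (1 / real w)) ^ n \<le> exp (0.07 * real w)" .
  have "real t ^ t / real n ^ t = (1 - x) ^ t" using n0 by (simp add: tn power_mult_distrib)
  also have "\<dots> \<le> exp (- x) ^ t"
    using x exp_ge_add_one_self[of "- x"] by (intro power_mono) auto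
  also have "\<dots> = exp (- (x * real t))" by (simp add: exp_of_nat_mult[symmetric] mult.commute)
  also have "x * real t = real w - x * real w"
    using n0 by (simp add: tn x_def field_simps)
  finally have t: "real t ^ t / real n ^ t \<le> exp (- (real w - x * real w))" .
  have nn: "real n ^ n = real n ^ t * real n ^ w" using w by (simp add: t_def power_add[symmetric])
  have "exp (real w) * real t ^ t / real n ^ n * ((1 + 700 * (1 / real w)) ^ n / (1 / real w) ^ w)
      = (exp (real w) * x ^ w) * ((real t ^ t / real n ^ t) * (1 + 700 * (1 / real w)) ^ n)"
    unfolding nn using n0 w0 by (simp add: x_def power_divide field_simps)
  also have "\<dots> \<le> (exp (real w) * x ^ w) * (exp (- (real w - x * real w)) * exp (0.07 * real w))"
    using x by (intro mult_left_mono mult_mono t e) auto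
  also have "\<dots> = x ^ w * exp (real w * (x + 0.07))"
    by (simp add: exp_add[symmetric] algebra_simps)
  also have "\<dots> = (x * exp (x + 0.07)) ^ w"
    by (simp add: power_mult_distrib exp_of_nat_mult)
  also have "\<dots> \<le> (1 / 2 * exp 0.57) ^ w"
    using x by (intro power_mono mult_mono) auto
  also have "\<dots> \<le> 0.95 ^ w"
    using exp_bound[of "0.57::real"] by (intro power_mono) (auto simp: power2_eq_square)
  finally show ?thesis .
qed

text \<open>With \<open>t\<close> as cutoff the powers combine to exp w * s^n, where s = (t +
  700)/n, that is to exp 700 * (s exp(1 - s))^n. The condition n >= 7000 keeps s <= 1/2 + 1/10, away
  from s = 1, where s exp(1 - s) attains its maximum 1.\<close>

lemma large_regime:
  fixes n t :: nat
  assumes t: "1 \<le> t" "2 * t \<le> n" and n: "n \<ge> 7000"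
  defines "w \<equiv> n - t"
  shows "exp (real w) * real t ^ t / real n ^ n * ((1 + 700 * (1 / real t)) ^ n / (1 / real t) ^ w)
    \<le> exp 700 * 0.95 ^ n"
proof -
  have n0: "real n > 0" and t0: "real t > 0" using t by auto
  define s where "s = (real t + 700) / real n"
  have s: "0 < s" "s \<le> 0.6" using t n n0 by (auto simp: s_def field_simps)
  have w: "real w = 700 + real n * (1 - s)" using t n0 by (simp add: w_def s_def field_simps of_nat_diff)
  have tt: "real t ^ n = real t ^ t * real t ^ w" using t by (simp add: w_def power_add[symmetric])
  have "exp (real w) * real t ^ t / real n ^ n * ((1 + 700 * (1 / real t)) ^ n / (1 / real t) ^ w)
      = exp (real w) * (real t ^ t * real t ^ w) / real n ^ n * (1 + 700 * (1 / real t)) ^ n"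
    using t0 by (simp add: power_divide)
  also have "\<dots> = exp (real w) * (real t * (1 + 700 * (1 / real t)) / real n) ^ n"
    unfolding tt[symmetric] by (simp add: power_mult_distrib power_divide)
  also have "real t * (1 + 700 * (1 / real t)) / real n = s"
    using t0 by (simp add: s_def distrib_left)
  also have "exp (real w) * s ^ n = exp 700 * (s * exp (1 - s)) ^ n"
    unfolding w by (simp add: exp_add power_mult_distrib exp_of_nat_mult)
  also have "\<dots> \<le> exp 700 * 0.95 ^ n"
  proof -
    \<comment> \<open>This gives s exp(-s) <= 0.6 exp(-0.6) from the tangent line of exp
      alone.\<close>
    have "1 - (0.6 - s) \<le> exp (- (0.6 - s))" using exp_ge_add_one_self[of "- (0.6 - s)"] by simp
    moreover have "s / 0.6 \<le> 1 - (0.6 - s)" using s by simp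
    ultimately have "s \<le> 0.6 * exp (- (0.6 - s))" by simp
    then have "s * exp (1 - s) \<le> 0.6 * exp (- (0.6 - s)) * exp (1 - s)" by (intro mult_right_mono) auto
    also have "\<dots> = 0.6 * exp 0.4" by (simp add: exp_add[symmetric])
    also have "\<dots> \<le> 0.95" using exp_bound[of "0.4::real"] by (simp add: power2_eq_square)
    finally show ?thesis using s by (intro mult_left_mono power_mono) auto
  qed
  finally show ?thesis .
qed

section \<open>Characters of the xor group and the Fourier transform of a random permutation\<close>

locale xor_group =
  fixes d :: nat
begin

abbreviation N :: nat where "N \<equiv> 2 ^ d"
abbreviation I :: "nat set" where "I \<equiv> {..<2 ^ d}"

text \<open>The pairing (-1)^(a . x) of bit vectors. It is real because the group has exponent 2,
  and its symmetry identifies the group with its dual, so characters are indexed by the same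
  numbers.\<close>

definition chi :: "nat \<Rightarrow> nat \<Rightarrow> real" where
  "chi a x = (\<Prod>i<d. if bit a i \<and> bit x i then - 1 else 1)"

lemma chi_commute: "chi a x = chi x a"
  unfolding chi_def by (simp add: conj_commute)

lemma chi_xor_right: "chi a (xor x y) = chi a x * chi a y"
  unfolding chi_def prod.distrib[symmetric]
  by (intro prod.cong) (auto simp: bit_xor_iff)

lemma chi_xor_left: "chi (xor x y) a = chi x a * chi y a"
  using chi_xor_right[of a x y] by (simp add: chi_commute)

lemma chi_zero [simp]: "chi 0 x = 1" "chi x 0 = 1"
  unfolding chi_def by simp_all

lemma chi_mult_self [simp]: "chi a x * chi a x = 1"
  unfolding chi_def prod.distrib[symmetric] by (intro prod.neutral) auto

lemma abs_chi [simp]: "\<bar>chi a x\<bar> = 1"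
  using chi_mult_self[of a x] by (metis abs_mult_self_eq abs_1 abs_ge_zero abs_mult power2_eq_1_iff power2_eq_square abs_minus_cancel)

lemma xor_less: "x < N \<Longrightarrow> y < N \<Longrightarrow> xor x y < N"
  by (metis take_bit_nat_eq_self_iff take_bit_xor)

lemma xor_cancel [simp]: "xor (xor x y) y = (x :: nat)"
  by (simp add: xor.assoc)

lemma xor_eq_0_iff: "xor x y = 0 \<longleftrightarrow> x = (y :: nat)"
  by (metis xor_cancel xor.left_neutral xor_self_eq)

lemma xor_inj_iff [simp]: "xor x y = xor z y \<longleftrightarrow> x = (z :: nat)"
  by (metis xor_cancel)

lemma bij_betw_xor: "y < N \<Longrightarrow> bij_betw (\<lambda>x. xor x y) I I"
  by (rule bij_betw_byWitness[where f' = "\<lambda>x. xor x y"]) (auto intro: xor_less)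

lemma sum_chi: "a \<in> I \<Longrightarrow> (\<Sum>x\<in>I. chi a x) = (if a = 0 then real N else 0)"
proof (cases "a = 0")
  case False
  assume a: "a \<in> I"
  obtain i where i: "bit a i" using False by (metis bit_0_eq bit_eq_iff bot_apply bot_bool_def)
  have id: "i < d"
  proof (rule ccontr)
    assume "\<not> i < d"
    then have "\<not> bit (take_bit d a) i" by (simp add: bit_take_bit_iff)
    moreover have "take_bit d a = a" using a by (simp add: take_bit_nat_eq_self_iff)
    ultimately show False using i by simp
  qed
  have iI: "2 ^ i < N" using id by simp
  have m: "chi a (2 ^ i) = - 1"
  proof -
    have "chi a (2 ^ i) = (\<Prod>j<d. if j = i then - 1 else 1)"
      unfolding chi_def using i by (intro prod.cong) (auto simp: bit_exp_iff)
    then show ?thesis using id by simp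
  qed
  \<comment> \<open>Translation by a bit that is set in \<open>a\<close> changes the sign of every
    term.\<close>
  have "(\<Sum>x\<in>I. chi a x) = (\<Sum>x\<in>I. chi a (xor x (2 ^ i)))"
    using sum.reindex_bij_betw[OF bij_betw_xor[OF iI], of "chi a"] by simp
  also have "\<dots> = - (\<Sum>x\<in>I. chi a x)"
    by (simp add: chi_xor_right m sum_negf)
  finally show ?thesis using False by simp
qed simp

lemma chi_orthogonal:
  assumes "a \<in> I" "b \<in> I"
  shows "(\<Sum>x\<in>I. chi a x * chi b x) = (if a = b then real N else 0)"
proof -
  have "(\<Sum>x\<in>I. chi a x * chi b x) = (\<Sum>x\<in>I. chi (xor a b) x)"
    by (simp add: chi_xor_left)
  also have "\<dots> = (if xor a b = 0 then real N else 0)"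
    using assms by (intro sum_chi) (auto intro: xor_less)
  finally show ?thesis by (simp add: xor_eq_0_iff)
qed

lemma chi_eqI:
  assumes "a \<in> I" "b \<in> I" "\<And>y. y \<in> I \<Longrightarrow> chi a y = chi b y"
  shows "a = b"
proof (rule ccontr)
  assume "a \<noteq> b"
  then have "(\<Sum>x\<in>I. chi a x * chi b x) = 0"
    using chi_orthogonal[OF assms(1,2)] by simp
  moreover have "(\<Sum>x\<in>I. chi a x * chi b x) = (\<Sum>x\<in>I. 1)"
    using assms(3) by (intro sum.cong) auto
  ultimately show False by simp
qed

text \<open>The product runs over all \<open>N\<close> points; a character of fewer points is one
  that is 0 elsewhere, since \<open>chi 0\<close> is trivial. One function thus serves every number
  of queries.\<close>

definition hat :: "(nat \<Rightarrow> nat) \<Rightarrow> real" where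
  "hat a = (\<Sum>p | p permutes I. \<Prod>i\<in>I. chi (a i) (p i)) / fact N"

lemma finite_perms: "finite {p. p permutes I}"
  by (rule finite_permutations) simp

lemma hat_cong: "(\<And>i. i \<in> I \<Longrightarrow> a i = b i) \<Longrightarrow> hat a = hat b"
  unfolding hat_def by simp

text \<open>Substituting the inverse permutation moves \<open>p\<close> into the argument of
  \<open>a\<close>. The transform becomes an average over rearrangements of \<open>a\<close>, the
  form used by \<open>hat_comp_perm\<close>, \<open>hat_xor\<close> and
  \<open>hat_orbit\<close>.\<close>

lemma hat_alt: "hat a = (\<Sum>p | p permutes I. \<Prod>x\<in>I. chi (a (p x)) x) / fact N"
proof -
  have "(\<Sum>p | p permutes I. \<Prod>i\<in>I. chi (a i) (p i))
      = (\<Sum>p | p permutes I. \<Prod>i\<in>I. chi (a i) (inv p i))"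
    by (rule sum_permutations_inverse)
  also have "\<dots> = (\<Sum>p | p permutes I. \<Prod>x\<in>I. chi (a (p x)) x)"
  proof (intro sum.cong refl)
    fix p assume "p \<in> {p. p permutes I}"
    then have p: "p permutes I" by simp
    have "(\<Prod>i\<in>I. chi (a i) (inv p i)) = (\<Prod>x\<in>I. chi (a (p x)) (inv p (p x)))"
      using prod.reindex_bij_betw[OF permutes_imp_bij[OF p], of "\<lambda>i. chi (a i) (inv p i)"] by simp
    then show "(\<Prod>i\<in>I. chi (a i) (inv p i)) = (\<Prod>x\<in>I. chi (a (p x)) x)"
      by (simp add: permutes_inverses[OF p])
  qed
  finally show ?thesis unfolding hat_def by simp
qed

lemma hat_comp_perm:
  assumes "s permutes I"
  shows "hat (a \<circ> s) = hat a"
proof -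
  have "(\<Sum>p | p permutes I. \<Prod>x\<in>I. chi (a (p x)) x)
      = (\<Sum>p | p permutes I. \<Prod>x\<in>I. chi (a ((s \<circ> p) x)) x)"
    by (rule setum_permutations_compose_left[OF assms])
  then show ?thesis unfolding hat_alt by simp
qed

text \<open>A permutation takes each value exactly once, so its pairing with a constant character is
  the same for all permutations.\<close>

lemma hat_xor: "hat (\<lambda>i. xor (a i) g) = (\<Prod>x\<in>I. chi g x) * hat a"
  unfolding hat_alt by (simp add: chi_xor_left prod.distrib sum_distrib_left mult.commute sum_divide_distrib)

lemma hat_xor_pow4: "hat (\<lambda>i. xor (a i) g) ^ 4 = hat a ^ 4"
proof -
  have "\<bar>\<Prod>x\<in>I. chi g x\<bar> = 1" by (simp add: abs_prod)
  then have "(\<Prod>x\<in>I. chi g x) ^ 2 = 1" by (metis abs_1 power2_abs power_one)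
  then have "(\<Prod>x\<in>I. chi g x) ^ (2 * 2) = 1" by (metis power_mult power_one)
  then show ?thesis by (simp add: hat_xor power_mult_distrib)
qed

text \<open>The law of a random permutation is invariant under adding \<open>y\<close> to all
  values, which multiplies \<open>hat a\<close> by this product. For all \<open>y\<close> together
  the condition says that the xor of the \<open>a i\<close> is 0.\<close>

lemma hat_nonzero_imp:
  assumes "hat a \<noteq> 0" "y \<in> I"
  shows "(\<Prod>i\<in>I. chi (a i) y) = 1"
proof -
  define s where "s = (\<lambda>x. if x \<in> I then xor x y else x)"
  have "bij_betw s I I"
    using bij_betw_xor[of y] assms(2) by (subst bij_betw_cong[of _ _ "\<lambda>x. xor x y"]) (auto simp: s_def)
  then have s: "s permutes I"
    by (rule bij_imp_permutes) (simp add: s_def)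
  have "(\<Sum>p | p permutes I. \<Prod>i\<in>I. chi (a i) (p i))
      = (\<Sum>p | p permutes I. \<Prod>i\<in>I. chi (a i) ((s \<circ> p) i))"
    by (rule setum_permutations_compose_left[OF s])
  also have "\<dots> = (\<Sum>p | p permutes I. (\<Prod>i\<in>I. chi (a i) y) * (\<Prod>i\<in>I. chi (a i) (p i)))"
  proof (intro sum.cong refl)
    fix p assume "p \<in> {p. p permutes I}"
    then have p: "p permutes I" by simp
    have "(\<Prod>i\<in>I. chi (a i) ((s \<circ> p) i)) = (\<Prod>i\<in>I. chi (a i) y * chi (a i) (p i))"
    proof (intro prod.cong refl)
      fix i assume "i \<in> I"
      then have "p i \<in> I" using permutes_in_image[OF p] by blast
      then show "chi (a i) ((s \<circ> p) i) = chi (a i) y * chi (a i) (p i)"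
        by (simp add: s_def chi_xor_right)
    qed
    then show "(\<Prod>i\<in>I. chi (a i) ((s \<circ> p) i)) = (\<Prod>i\<in>I. chi (a i) y) * (\<Prod>i\<in>I. chi (a i) (p i))"
      by (simp add: prod.distrib)
  qed
  finally have "hat a = (\<Prod>i\<in>I. chi (a i) y) * hat a"
    unfolding hat_def by (simp only: sum_distrib_left[symmetric] times_divide_eq_right)
  then show ?thesis using assms(1) by simp
qed

lemma hat_single:
  assumes "j \<in> I" "a j \<noteq> 0" "a j \<in> I" "\<And>i. i \<in> I \<Longrightarrow> i \<noteq> j \<Longrightarrow> a i = 0"
  shows "hat a = 0"
proof (rule ccontr)
  assume h: "hat a \<noteq> 0"
  have "chi (a j) y = chi 0 y" if "y \<in> I" for y
  proof -
    have "(\<Prod>i\<in>I. chi (a i) y) = chi (a j) y * (\<Prod>i\<in>I - {j}. chi (a i) y)"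
      using assms(1) by (intro prod.remove) auto
    also have "(\<Prod>i\<in>I - {j}. chi (a i) y) = 1" using assms(4) by (intro prod.neutral) auto
    finally show ?thesis using hat_nonzero_imp[OF h that] by simp
  qed
  then have "a j = 0" using assms(3) by (intro chi_eqI) auto
  then show False using assms(2) by simp
qed

lemma hat_const_zero: "hat (\<lambda>_. 0) = 1"
  unfolding hat_def by (simp add: card_permutations)

end

section \<open>Size of the Fourier coefficients\<close>

lemma prod_image_mset_set:
  fixes h :: "'b \<Rightarrow> 'c :: comm_monoid_mult"
  assumes "finite S" "finite T" "b ` S \<subseteq> T"
  shows "(\<Prod>x\<in>S. h (b x)) = (\<Prod>g\<in>T. h g ^ count (image_mset b (mset_set S)) g)"
proof -
  have "(\<Prod>x\<in>S. h (b x)) = prod_mset (image_mset h (image_mset b (mset_set S)))"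
    by (simp only: prod_unfold_prod_mset multiset.map_comp o_def)
  also have "\<dots> = (\<Prod>g\<in>set_mset (image_mset b (mset_set S)). h g ^ count (image_mset b (mset_set S)) g)"
    by (rule image_prod_mset_multiplicity)
  also have "\<dots> = (\<Prod>g\<in>T. h g ^ count (image_mset b (mset_set S)) g)"
  proof (intro prod.mono_neutral_left)
    show "\<forall>g\<in>T - set_mset (image_mset b (mset_set S)). h g ^ count (image_mset b (mset_set S)) g = 1"
    proof
      fix g assume "g \<in> T - set_mset (image_mset b (mset_set S))"
      then have "count (image_mset b (mset_set S)) g = 0" by (simp only: count_eq_zero_iff Diff_iff not_False_eq_True)
      then show "h g ^ count (image_mset b (mset_set S)) g = 1" by (simp only: power_0)
    qed
  qed (use assms in auto)
  finally show ?thesis .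
qed

text \<open>Discretises the averages over circles: exponents below \<open>M\<close> are distinct
  modulo \<open>M\<close>, so the \<open>M\<close>-th roots of unity separate them exactly.\<close>

lemma sum_roots_of_unity:
  fixes M c e :: nat
  assumes "c < M" "e < M"
  defines "w \<equiv> \<lambda>k::nat. cis (2 * pi * real k / real M)"
  shows "(\<Sum>k<M. w k ^ c * cnj (w k) ^ e) = (if c = e then of_nat M else 0)"
proof -
  have M: "M > 0" using assms by simp
  define z where "z = cis (2 * pi * (real c - real e) / real M)"
  have wz: "w k ^ c * cnj (w k) ^ e = z ^ k" for k
    unfolding w_def z_def cis_cnj Complex.DeMoivre cis_mult
    by (rule arg_cong[of _ _ cis]) (simp add: right_diff_distrib diff_divide_distrib mult_ac)
  show ?thesis
  proof (cases "c = e")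
    case True
    then show ?thesis unfolding wz by (simp add: z_def)
  next
    case False
    have "z \<noteq> 1"
    proof
      assume "z = 1"
      then have "cos (2 * pi * (real c - real e) / real M) = 1"
        by (simp add: z_def complex_eq_iff)
      then obtain j :: int where "2 * pi * (real c - real e) / real M = of_int j * 2 * pi"
        using cos_one_2pi_int by metis
      then have "2 * pi * (real c - real e) = 2 * pi * (real_of_int j * real M)"
        using M by (simp add: field_simps)
      then have "real c - real e = real_of_int j * real M" by simp
      then have "real_of_int (int c - int e) = real_of_int (j * int M)" by simp
      then have "int c - int e = j * int M" by (simp only: of_int_eq_iff)
      moreover have "\<bar>int c - int e\<bar> < int M" using assms by linarith
      ultimately have "\<bar>j\<bar> * int M < 1 * int M" by (simp add: abs_mult)
      then have "\<bar>j\<bar> < 1" by (rule mult_right_less_imp_less) simp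
      then have "j = 0" by simp
      with \<open>int c - int e = j * int M\<close> False show False by simp
    qed
    moreover have "z ^ M = 1"
    proof -
      have "z ^ M = cis (real M * (2 * pi * (real c - real e) / real M))"
        unfolding z_def Complex.DeMoivre by (rule refl)
      also have "real M * (2 * pi * (real c - real e) / real M) = 2 * pi * of_int (int c - int e)"
        using M by simp
      also have "cis \<dots> = 1" by (rule cis_multiple_2pi) simp
      finally show ?thesis .
    qed
    ultimately show ?thesis using False unfolding wz by (simp add: geometric_sum)
  qed
qed

context xor_group
begin

definition orbit :: "nat multiset \<Rightarrow> (nat \<Rightarrow> nat) set" where
  "orbit A = {b \<in> I \<rightarrow>\<^sub>E I. image_mset b (mset_set I) = A}"

lemma finite_orbit [simp]: "finite (orbit A)"
  unfolding orbit_def by (rule finite_subset[of _ "I \<rightarrow>\<^sub>E I"]) (auto intro: finite_PiE)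

text \<open>Sending \<open>p\<close> to the restriction of \<open>a \<circ> p\<close> maps the
  permutations to the orbit with fibres of constant size: if b = a o q on \<open>I\<close>,
  composition with the inverse of \<open>q\<close> carries the fibre over \<open>b\<close> to the
  fibre over \<open>a\<close>. Averages over permutations thus become averages over the
  orbit.\<close>

lemma hat_orbit:
  assumes a: "a \<in> orbit A"
  shows "hat a * real (card (orbit A)) = (\<Sum>b\<in>orbit A. \<Prod>x\<in>I. chi (b x) x)"
proof -
  define P where "P = {p. p permutes I}"
  define r where "r p = restrict (a \<circ> p) I" for p
  define K where "K b = {p \<in> P. r p = b}" for b
  have finP: "finite P" unfolding P_def by (rule finite_perms)
  have aI: "a \<in> I \<rightarrow>\<^sub>E I" and aA: "image_mset a (mset_set I) = A"
    using a by (auto simp: orbit_def)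
  have rP: "r ` P \<subseteq> orbit A"
  proof
    fix b assume "b \<in> r ` P"
    then obtain p where p: "p permutes I" and b: "b = r p" by (auto simp: P_def)
    have "image_mset b (mset_set I) = image_mset a (image_mset p (mset_set I))"
      unfolding b r_def multiset.map_comp by (intro image_mset_cong) auto
    also have "image_mset p (mset_set I) = mset_set I"
      by (simp add: image_mset_mset_set permutes_inj_on[OF p] permutes_image[OF p])
    finally have "image_mset b (mset_set I) = A" by (simp add: aA)
    moreover have "b \<in> I \<rightarrow>\<^sub>E I"
      unfolding b r_def restrict_PiE_iff o_def
    proof
      fix i assume "i \<in> I"
      then have "p i \<in> I" using permutes_in_image[OF p] by blast
      then show "a (p i) \<in> I" using aI by (rule PiE_mem[rotated])
    qed
    ultimately show "b \<in> orbit A" by (simp add: orbit_def)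
  qed
  define \<kappa> where "\<kappa> = card (K a)"
  have K: "card (K b) = \<kappa>" if b: "b \<in> orbit A" for b
  proof -
    have "image_mset b (mset_set I) = image_mset a (mset_set I)"
      using b aA by (simp add: orbit_def)
    then obtain q where q: "q permutes I" and ba: "\<forall>x\<in>I. b x = a (q x)"
      by (rule image_mset_eq_implies_permutes[rotated]) auto
    have qI: "inv q permutes I" using q by (rule permutes_inv)
    have bI: "b \<in> extensional I" "a \<in> extensional I"
      using b aI by (auto simp: orbit_def PiE_def)
    have "bij_betw (\<lambda>p. p \<circ> inv q) (K b) (K a)"
    proof (rule bij_betw_byWitness[where f' = "\<lambda>p. p \<circ> q"])
      show "\<forall>p\<in>K b. p \<circ> inv q \<circ> q = p"
        by (simp add: o_assoc[symmetric] permutes_inv_o[OF q])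
      show "\<forall>p\<in>K a. p \<circ> q \<circ> inv q = p"
        by (simp add: o_assoc[symmetric] permutes_inv_o[OF q])
      show "(\<lambda>p. p \<circ> inv q) ` K b \<subseteq> K a"
      proof clarify
        fix p assume "p \<in> K b"
        then have p: "p permutes I" and r: "restrict (a \<circ> p) I = b"
          by (auto simp: K_def P_def r_def)
        have p': "a (p x) = b x" if "x \<in> I" for x
          using fun_cong[OF r, of x] that by simp
        have "a (p (inv q x)) = a x" if "x \<in> I" for x
        proof -
          have "inv q x \<in> I" using permutes_in_image[OF qI] that by blast
          then show ?thesis using p' ba permutes_inverses[OF q] by metis
        qed
        then show "p \<circ> inv q \<in> K a"
          using permutes_compose[OF qI p] bI
          by (auto simp: K_def P_def r_def intro!: extensionalityI[of _ I])
      qed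
      show "(\<lambda>p. p \<circ> q) ` K a \<subseteq> K b"
      proof clarify
        fix p assume "p \<in> K a"
        then have p: "p permutes I" and r: "restrict (a \<circ> p) I = a"
          by (auto simp: K_def P_def r_def)
        have p': "a (p x) = a x" if "x \<in> I" for x
          using fun_cong[OF r, of x] that by simp
        have "a (p (q x)) = b x" if "x \<in> I" for x
        proof -
          have "q x \<in> I" using permutes_in_image[OF q] that by blast
          then show ?thesis using p' ba that by metis
        qed
        then show "p \<circ> q \<in> K b"
          using permutes_compose[OF q p] bI
          by (auto simp: K_def P_def r_def intro!: extensionalityI[of _ I])
      qed
    qed
    then show ?thesis unfolding \<kappa>_def by (rule bij_betw_same_card)
  qed
  have group: "(\<Sum>p\<in>P. f (r p)) = real \<kappa> * (\<Sum>b\<in>orbit A. f b)" for f :: "(nat \<Rightarrow> nat) \<Rightarrow> real"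
  proof -
    have "(\<Sum>p\<in>P. f (r p)) = (\<Sum>b\<in>orbit A. \<Sum>p\<in>K b. f (r p))"
      using sum.group[OF finP finite_orbit rP, of "\<lambda>p. f (r p)"] by (simp add: K_def)
    also have "\<dots> = (\<Sum>b\<in>orbit A. \<Sum>p\<in>K b. f b)"
      by (intro sum.cong refl) (auto simp: K_def)
    also have "\<dots> = (\<Sum>b\<in>orbit A. real \<kappa> * f b)"
      by (intro sum.cong refl) (simp add: K)
    finally show ?thesis by (simp add: sum_distrib_left)
  qed
  have cP: "real \<kappa> * real (card (orbit A)) = fact N"
    using group[of "\<lambda>_. 1"] by (simp add: P_def card_permutations)
  have "hat a * fact N = (\<Sum>p\<in>P. \<Prod>x\<in>I. chi (r p x) x)"
    by (simp add: hat_alt P_def r_def)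
  also have "\<dots> = real \<kappa> * (\<Sum>b\<in>orbit A. \<Prod>x\<in>I. chi (b x) x)"
    by (rule group)
  finally have "real \<kappa> * (hat a * real (card (orbit A))) = real \<kappa> * (\<Sum>b\<in>orbit A. \<Prod>x\<in>I. chi (b x) x)"
    by (simp add: cP[symmetric] mult_ac)
  moreover have "real \<kappa> \<noteq> 0"
    using cP fact_nonzero[of N, where 'a = real] by (metis mult_zero_left)
  ultimately show ?thesis by simp
qed

text \<open>The multinomial coefficient: listing the values of \<open>b\<close> turns the orbit into
  \<open>permutations_of_multiset A\<close>.\<close>

lemma card_orbit:
  assumes "size A = N" "set_mset A \<subseteq> I"
  shows "real (card (orbit A)) * (\<Prod>g\<in>I. fact (count A g)) = fact N"
proof -
  have "bij_betw (\<lambda>b. map b [0..<N]) (orbit A) (permutations_of_multiset A)"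
  proof (rule bij_betw_byWitness[where f' = "\<lambda>xs. restrict (\<lambda>i. xs ! i) I"])
    show "\<forall>b\<in>orbit A. restrict ((!) (map b [0..<N])) I = b"
      by (auto simp: orbit_def fun_eq_iff PiE_def extensional_def)
    show "\<forall>xs\<in>permutations_of_multiset A. map (restrict ((!) xs) I) [0..<N] = xs"
    proof
      fix xs assume "xs \<in> permutations_of_multiset A"
      then have "length xs = N" using assms(1) by (auto simp: permutations_of_multiset_def)
      then show "map (restrict ((!) xs) I) [0..<N] = xs"
        by (intro nth_equalityI) auto
    qed
    show "(\<lambda>b. map b [0..<N]) ` orbit A \<subseteq> permutations_of_multiset A"
    proof clarify
      fix b assume "b \<in> orbit A"
      then have "image_mset b (mset_set I) = A" by (simp add: orbit_def)
      then have "mset (map b [0..<N]) = A" by (simp only: mset_map mset_upt atLeast0LessThan)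
      then show "map b [0..<N] \<in> permutations_of_multiset A"
        by (simp only: permutations_of_multiset_def mem_Collect_eq)
    qed
    show "(\<lambda>xs. restrict ((!) xs) I) ` permutations_of_multiset A \<subseteq> orbit A"
    proof clarify
      fix xs assume "xs \<in> permutations_of_multiset A"
      then have xs: "mset xs = A" by (auto simp: permutations_of_multiset_def)
      then have len: "length xs = N" using assms(1) by auto
      have "image_mset (restrict ((!) xs) I) (mset_set I) = mset (map ((!) xs) [0..<N])"
        unfolding mset_map mset_upt atLeast0LessThan by (intro image_mset_cong) auto
      also have "map ((!) xs) [0..<N] = xs" using len map_nth by metis
      finally have "image_mset (restrict ((!) xs) I) (mset_set I) = A" by (simp only: xs)
      moreover have "restrict ((!) xs) I \<in> I \<rightarrow>\<^sub>E I"
      proof (rule restrict_PiE_iff[THEN iffD2], rule ballI)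
        fix i assume "i \<in> I"
        then have "xs ! i \<in> set_mset (mset xs)" using len by simp
        then show "xs ! i \<in> I" unfolding xs using assms(2) by blast
      qed
      ultimately show "restrict ((!) xs) I \<in> orbit A"
        unfolding orbit_def by blast
    qed
  qed
  then have "card (orbit A) = card (permutations_of_multiset A)"
    by (rule bij_betw_same_card)
  moreover have "(\<Prod>g\<in>I. fact (count A g)) = (\<Prod>g\<in>set_mset A. fact (count A g) :: nat)"
    using assms(2) by (intro prod.mono_neutral_right) (auto simp: not_in_iff)
  ultimately have "card (orbit A) * (\<Prod>g\<in>I. fact (count A g)) = (fact N :: nat)"
    using card_permutations_of_multiset_aux[of A] assms(1) by simp
  then have "real (card (orbit A) * (\<Prod>g\<in>I. fact (count A g))) = real (fact N)" by (rule arg_cong)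
  then show ?thesis by simp
qed

lemma parseval_linear_forms:
  fixes z :: "nat \<Rightarrow> complex"
  shows "(\<Sum>x\<in>I. (cmod (\<Sum>g\<in>I. z g * of_real (chi g x)))\<^sup>2) = real N * (\<Sum>g\<in>I. (cmod (z g))\<^sup>2)"
proof -
  have "complex_of_real (\<Sum>x\<in>I. (cmod (\<Sum>g\<in>I. z g * of_real (chi g x)))\<^sup>2)
      = (\<Sum>x\<in>I. (\<Sum>g\<in>I. z g * of_real (chi g x)) * cnj (\<Sum>g\<in>I. z g * of_real (chi g x)))"
    by (simp only: complex_norm_square of_real_sum)
  also have "\<dots> = (\<Sum>x\<in>I. \<Sum>g\<in>I. \<Sum>h\<in>I. z g * cnj (z h) * of_real (chi g x * chi h x))"
    by (simp add: sum_product mult_ac)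
  also have "\<dots> = (\<Sum>g\<in>I. \<Sum>h\<in>I. \<Sum>x\<in>I. z g * cnj (z h) * of_real (chi g x * chi h x))"
    by (subst sum.swap, rule sum.cong, rule refl, rule sum.swap)
  also have "\<dots> = (\<Sum>g\<in>I. \<Sum>h\<in>I. z g * cnj (z h) * of_real (if g = h then real N else 0))"
    by (intro sum.cong refl) (simp only: sum_distrib_left[symmetric] of_real_sum[symmetric] chi_orthogonal)
  also have "\<dots> = (\<Sum>g\<in>I. \<Sum>h\<in>I. if g = h then z g * cnj (z h) * of_real (real N) else 0)"
    by (intro sum.cong refl) simp
  also have "\<dots> = (\<Sum>g\<in>I. z g * cnj (z g) * of_real (real N))"
    by (simp add: sum.delta)
  also have "\<dots> = complex_of_real (real N * (\<Sum>g\<in>I. (cmod (z g))\<^sup>2))"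
    by (simp add: complex_norm_square[symmetric] sum_distrib_left mult.commute)
  finally show ?thesis by (simp only: of_real_eq_iff)
qed

lemma prod_linear_forms_le:
  fixes z :: "nat \<Rightarrow> complex"
  shows "(\<Prod>x\<in>I. (cmod (\<Sum>g\<in>I. z g * of_real (chi g x)))\<^sup>2) \<le> (\<Sum>g\<in>I. (cmod (z g))\<^sup>2) ^ N"
proof -
  let ?f = "\<lambda>x. (cmod (\<Sum>g\<in>I. z g * of_real (chi g x)))\<^sup>2"
  have "root N (\<Prod>x\<in>I. ?f x) = (\<Prod>x\<in>I. ?f x) powr (1 / real N)"
    by (subst root_powr_inverse) (auto intro!: prod_nonneg)
  also have "\<dots> \<le> (\<Sum>x\<in>I. ?f x / real N)"
    using arith_geom_mean[of I ?f] by (simp add: lessThan_empty_iff)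
  also have "\<dots> = (\<Sum>x\<in>I. ?f x) / real N" by (rule sum_divide_distrib[symmetric])
  also have "\<dots> = (\<Sum>g\<in>I. (cmod (z g))\<^sup>2)"
    by (simp add: parseval_linear_forms)
  finally have "root N (\<Prod>x\<in>I. ?f x) ^ N \<le> (\<Sum>g\<in>I. (cmod (z g))\<^sup>2) ^ N"
    by (intro power_mono) (auto intro!: prod_nonneg)
  then show ?thesis by (simp add: real_root_pow_pos2 prod_nonneg)
qed

text \<open>The sum over the orbit is the coefficient of \<open>\<Prod>g. z g ^ count A g\<close> in a product of
  linear forms; it is extracted by averaging each \<open>z g\<close> over a circle of radius \<open>\<rho> g\<close>, where
  the product is controlled by AM-GM and orthogonality of the characters.\<close>

lemma orbit_coefficient_bound:
  fixes \<rho> :: "nat \<Rightarrow> real"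
  assumes \<rho>: "\<And>g. \<rho> g \<ge> 0" and A: "size A = N" "set_mset A \<subseteq> I"
  shows "(\<Sum>b\<in>orbit A. \<Prod>x\<in>I. chi (b x) x)\<^sup>2 * (\<Prod>g\<in>I. (\<rho> g)\<^sup>2 ^ count A g)
      \<le> (\<Sum>g\<in>I. (\<rho> g)\<^sup>2) ^ N"
proof -
  \<comment> \<open>Multiplicities run from 0 to \<open>N\<close>, so \<open>N + 1\<close> roots of
    unity tell them apart.\<close>
  define M where "M = Suc N"
  define w where "w k = cis (2 * pi * real k / real M)" for k :: nat
  define Kset where "Kset = I \<rightarrow>\<^sub>E {..<M}"
  define S where "S = (\<Sum>b\<in>orbit A. \<Prod>x\<in>I. chi (b x) x)"
  \<comment> \<open>\<open>F\<close> is the product of linear forms at a point of the discrete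
    torus, \<open>G\<close> the conjugate monomial that picks out the exponents of
    \<open>A\<close>.\<close>
  define F where "F k = (\<Prod>x\<in>I. \<Sum>g\<in>I. of_real (\<rho> g) * w (k g) * of_real (chi g x))" for k
  define G where "G k = (\<Prod>g\<in>I. cnj (w (k g)) ^ count A g)" for k
  define R where "R = (\<Sum>g\<in>I. (\<rho> g)\<^sup>2) ^ N"
  have nw: "cmod (w k) = 1" for k by (simp add: w_def)
  have finK: "finite Kset" unfolding Kset_def by (intro finite_PiE) auto
  have cardK: "card Kset = M ^ N" unfolding Kset_def by (simp add: card_PiE)
  have cM: "count B g < M" if "size B = N" for B :: "nat multiset" and g
    using count_le_size[of B g] that by (simp add: M_def)
  have expand: "(\<Sum>k\<in>Kset. F k * G k) = of_nat (M ^ N) * of_real ((\<Prod>g\<in>I. \<rho> g ^ count A g) * S)"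
  proof -
    have F: "F k = (\<Sum>b\<in>I \<rightarrow>\<^sub>E I. of_real (\<Prod>x\<in>I. \<rho> (b x) * chi (b x) x) * (\<Prod>x\<in>I. w (k (b x))))" for k
      unfolding F_def by (subst prod_sum_PiE) (auto simp: prod.distrib mult_ac)
    have inner: "(\<Sum>k\<in>Kset. (\<Prod>x\<in>I. w (k (b x))) * G k) = (if b \<in> orbit A then of_nat (M ^ N) else 0)"
      if b: "b \<in> I \<rightarrow>\<^sub>E I" for b
    proof -
      let ?B = "image_mset b (mset_set I)"
      have sB: "size ?B = N" by simp
      have bI: "b ` I \<subseteq> I" using b by auto
      have "(\<Prod>x\<in>I. w (k (b x))) = (\<Prod>g\<in>I. w (k g) ^ count ?B g)" for k
        by (rule prod_image_mset_set[OF _ _ bI, of "\<lambda>g. w (k g)"]) auto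
      then have "(\<Sum>k\<in>Kset. (\<Prod>x\<in>I. w (k (b x))) * G k)
          = (\<Sum>k\<in>Kset. \<Prod>g\<in>I. w (k g) ^ count ?B g * cnj (w (k g)) ^ count A g)"
        by (simp add: G_def prod.distrib)
      also have "\<dots> = (\<Prod>g\<in>I. \<Sum>k<M. w k ^ count ?B g * cnj (w k) ^ count A g)"
        unfolding Kset_def by (subst prod_sum_PiE) auto
      also have "\<dots> = (\<Prod>g\<in>I. if count ?B g = count A g then of_nat M else 0)"
        unfolding w_def using cM[OF sB] cM[OF A(1)] by (intro prod.cong refl sum_roots_of_unity) auto
      also have "\<dots> = (if b \<in> orbit A then of_nat (M ^ N) else 0)"
      proof (cases "b \<in> orbit A")
        case True
        then show ?thesis by (simp add: orbit_def)
      next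
        case False
        then have "?B \<noteq> A" using b by (simp add: orbit_def)
        then obtain g where g: "count ?B g \<noteq> count A g" by (meson multiset_eqI)
        have "g \<in> I"
        proof (rule ccontr)
          assume gI: "g \<notin> I"
          have "count ?B g = 0" using bI gI by (subst not_in_iff[symmetric]) auto
          moreover have "count A g = 0" using A(2) gI by (subst not_in_iff[symmetric]) auto
          ultimately show False using g by simp
        qed
        then show ?thesis using False g by (subst prod_zero) auto
      qed
      finally show ?thesis .
    qed
    have "(\<Sum>k\<in>Kset. F k * G k) = (\<Sum>b\<in>I \<rightarrow>\<^sub>E I. of_real (\<Prod>x\<in>I. \<rho> (b x) * chi (b x) x) *
        (\<Sum>k\<in>Kset. (\<Prod>x\<in>I. w (k (b x))) * G k))"
      unfolding F sum_distrib_right sum_distrib_left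
      by (subst sum.swap) (simp only: mult.assoc)
    also have "\<dots> = (\<Sum>b\<in>I \<rightarrow>\<^sub>E I. of_real (\<Prod>x\<in>I. \<rho> (b x) * chi (b x) x) *
        (if b \<in> orbit A then of_nat (M ^ N) else 0))"
      by (intro sum.cong refl) (simp only: inner)
    also have "\<dots> = (\<Sum>b\<in>orbit A. of_real (\<Prod>x\<in>I. \<rho> (b x) * chi (b x) x) * of_nat (M ^ N))"
      by (rule sum.mono_neutral_cong_right) (auto simp: orbit_def intro: finite_PiE)
    also have "\<dots> = (\<Sum>b\<in>orbit A. of_nat (M ^ N) *
        of_real ((\<Prod>g\<in>I. \<rho> g ^ count A g) * (\<Prod>x\<in>I. chi (b x) x)))"
    proof (intro sum.cong refl)
      fix b assume b: "b \<in> orbit A"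
      have "(\<Prod>x\<in>I. \<rho> (b x)) = (\<Prod>g\<in>I. \<rho> g ^ count A g)"
        using b by (subst prod_image_mset_set[of I I b]) (auto simp: orbit_def)
      then show "of_real (\<Prod>x\<in>I. \<rho> (b x) * chi (b x) x) * of_nat (M ^ N)
          = of_nat (M ^ N) * complex_of_real ((\<Prod>g\<in>I. \<rho> g ^ count A g) * (\<Prod>x\<in>I. chi (b x) x))"
        by (simp add: prod.distrib)
    qed
    finally show ?thesis unfolding S_def by (simp add: sum_distrib_left)
  qed
  have "cmod (F k * G k) \<le> sqrt R" for k
  proof -
    have G1: "cmod (G k) = 1" unfolding G_def by (simp add: norm_power nw prod_norm[symmetric])
    have "(cmod (F k))\<^sup>2 = (\<Prod>x\<in>I. (cmod (\<Sum>g\<in>I. of_real (\<rho> g) * w (k g) * of_real (chi g x)))\<^sup>2)"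
      unfolding F_def by (simp add: prod_norm[symmetric] prod_power_distrib)
    also have "\<dots> \<le> R"
      unfolding R_def using prod_linear_forms_le[of "\<lambda>g. of_real (\<rho> g) * w (k g)"]
      by (simp add: norm_mult nw)
    finally have "cmod (F k) \<le> sqrt R" by (rule real_le_rsqrt)
    then show ?thesis by (simp add: norm_mult G1)
  qed
  then have "cmod (\<Sum>k\<in>Kset. F k * G k) \<le> real (card Kset) * sqrt R"
    by (intro sum_norm_bound) auto
  then have "real (M ^ N) * \<bar>(\<Prod>g\<in>I. \<rho> g ^ count A g) * S\<bar> \<le> real (M ^ N) * sqrt R"
    unfolding expand cardK norm_mult norm_of_nat norm_of_real .
  then have "\<bar>(\<Prod>g\<in>I. \<rho> g ^ count A g) * S\<bar> \<le> sqrt R"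
    by (rule mult_left_le_imp_le) (simp only: M_def of_nat_power, rule zero_less_power, simp only: of_nat_0_less_iff zero_less_Suc)
  then have "((\<Prod>g\<in>I. \<rho> g ^ count A g) * S)\<^sup>2 \<le> R"
    by (simp add: real_le_rsqrt sqrt_ge_absD)
  moreover have "(\<Prod>g\<in>I. (\<rho> g)\<^sup>2 ^ count A g) = (\<Prod>g\<in>I. \<rho> g ^ count A g)\<^sup>2"
    by (simp add: prod_power_distrib power_mult[symmetric] mult.commute)
  ultimately show ?thesis
    unfolding R_def S_def by (simp add: power_mult_distrib mult.commute)
qed

text \<open>The orbit has Z elements, each with fourth power at most (N^N / (Z^2 P))^2, which leaves
  Z^3 in the denominator. Since Z is N! divided by the product of the c!, this is the origin of the
  cube in \<open>phi\<close>.\<close>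

lemma orbit_sum_le:
  assumes A: "size A = N" "set_mset A \<subseteq> I"
  shows "(\<Sum>b\<in>orbit A. hat b ^ 4) \<le> (\<Prod>g\<in>I. phi (count A g)) / phi N"
proof -
  define Z where "Z = real (card (orbit A))"
  define f where "f = (\<Prod>g\<in>I. fact (count A g) :: real)"
  define P where "P = (\<Prod>g\<in>I. real (count A g) ^ count A g)"
  have fpos: "f > 0" unfolding f_def by (intro prod_pos) auto
  have Ppos: "P > 0" unfolding P_def by (intro prod_pos) auto
  have Zf: "Z * f = fact N" unfolding Z_def f_def by (rule card_orbit[OF A])
  have Zpos: "Z > 0" using Zf fpos by (metis fact_gt_zero zero_less_mult_pos2)
  have sumA: "(\<Sum>g\<in>I. count A g) = N"
  proof -
    have "size A = (\<Sum>g\<in>set_mset A. count A g)" by (rule size_multiset_overloaded_eq)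
    also have "\<dots> = (\<Sum>g\<in>I. count A g)"
      using A(2) by (intro sum.mono_neutral_left) (auto simp: not_in_iff)
    finally show ?thesis using A(1) by simp
  qed
  then have sumA': "(\<Sum>g\<in>I. real (count A g)) = real N"
    by (simp only: of_nat_sum[symmetric])
  have bound: "hat b ^ 2 \<le> real N ^ N / (Z\<^sup>2 * P)" if b: "b \<in> orbit A" for b
  proof -
    \<comment> \<open>Among squared radii with sum 1, the choice count/N maximises the product on
      the left and so gives the strongest bound.\<close>
    have "(\<Sum>b\<in>orbit A. \<Prod>x\<in>I. chi (b x) x)\<^sup>2 * (\<Prod>g\<in>I. (sqrt (real (count A g) / real N))\<^sup>2 ^ count A g)
      \<le> (\<Sum>g\<in>I. (sqrt (real (count A g) / real N))\<^sup>2) ^ N"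
      by (rule orbit_coefficient_bound[OF _ A]) simp
    also have "(\<Sum>g\<in>I. (sqrt (real (count A g) / real N))\<^sup>2) = 1"
      using sumA' by (simp add: sum_divide_distrib[symmetric])
    also have "(\<Prod>g\<in>I. (sqrt (real (count A g) / real N))\<^sup>2 ^ count A g)
        = P / (\<Prod>g\<in>I. real N ^ count A g)"
      by (simp add: P_def power_divide prod_dividef)
    also have "(\<Prod>g\<in>I. real N ^ count A g) = real N ^ N"
      by (simp only: power_sum[symmetric] sumA)
    also have "(\<Sum>b\<in>orbit A. \<Prod>x\<in>I. chi (b x) x) = hat b * Z"
      unfolding Z_def by (rule hat_orbit[OF b, symmetric])
    finally have "(hat b * Z)\<^sup>2 * (P / real N ^ N) \<le> 1" by simp
    then show ?thesis using Zpos Ppos by (simp add: field_simps power_mult_distrib)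
  qed
  have "(\<Sum>b\<in>orbit A. hat b ^ 4) \<le> (\<Sum>b\<in>orbit A. (real N ^ N / (Z\<^sup>2 * P))\<^sup>2)"
  proof (rule sum_mono)
    fix b assume "b \<in> orbit A"
    from power_mono[OF bound[OF this], of 2]
    show "hat b ^ 4 \<le> (real N ^ N / (Z\<^sup>2 * P))\<^sup>2" by (simp add: power_mult[symmetric])
  qed
  also have "\<dots> = Z * (real N ^ N / (Z\<^sup>2 * P))\<^sup>2" by (simp add: Z_def)
  also have "\<dots> = (real N ^ N)\<^sup>2 / (Z ^ 3 * P\<^sup>2)"
    using Zpos by (simp add: field_simps power2_eq_square power3_eq_cube)
  also have "Z = fact N / f" using Zf fpos by (simp add: field_simps)
  also have "(real N ^ N)\<^sup>2 / ((fact N / f) ^ 3 * P\<^sup>2) = (f ^ 3 / P\<^sup>2) / phi N"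
    unfolding phi_def using fpos Ppos by (simp add: field_simps)
  also have "f ^ 3 / P\<^sup>2 = (\<Prod>g\<in>I. phi (count A g))"
    by (simp add: f_def P_def phi_def prod_power_distrib prod_dividef)
  finally show ?thesis .
qed

end

section \<open>Hybrid argument and adaptivity\<close>

definition xor_pmf :: "(nat \<Rightarrow> nat) pmf \<Rightarrow> (nat \<Rightarrow> nat) pmf \<Rightarrow> (nat \<Rightarrow> nat) pmf" where
  "xor_pmf G H = map_pmf (\<lambda>(g, h) x. xor (g x) (h x)) (pair_pmf G H)"

lemma xor_pmf_commute: "xor_pmf G H = xor_pmf H G"
  unfolding xor_pmf_def
  by (subst pair_commute_pmf) (simp add: pmf.map_comp o_def case_prod_unfold xor.commute)

text \<open>Simulates the oracle g xor h with queries to \<open>g\<close> alone, correcting each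
  answer before it is passed on. The whole of \<open>h\<close> is later drawn as part of the coins,
  which is legitimate since only queries are counted.\<close>

primrec xor_strat :: "(nat \<Rightarrow> nat) \<Rightarrow> strat \<Rightarrow> strat" where
  "xor_strat h (Out b) = Out b"
| "xor_strat h (Query x c) = Query x (\<lambda>y. xor_strat h (c (xor y (h x))))"

lemma run_xor_strat: "run_strat g (xor_strat h S) = run_strat (\<lambda>x. xor (g x) (h x)) S"
  by (induction S) auto

lemma queries_le_xor_strat: "queries_le d n S \<Longrightarrow> queries_le d n (xor_strat h S)"
  by (induction rule: queries_le.induct) (auto intro: queries_le.intros)

definition xor_dist :: "(nat \<Rightarrow> nat) pmf \<Rightarrow> strat pmf \<Rightarrow> strat pmf" where
  "xor_dist H A = bind_pmf A (\<lambda>S. map_pmf (\<lambda>h. xor_strat h S) H)"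

lemma is_distinguisher_xor_dist:
  "is_distinguisher d m A \<Longrightarrow> is_distinguisher d m (xor_dist H A)"
  unfolding is_distinguisher_def xor_dist_def by (auto intro: queries_le_xor_strat)

lemma accept_prob_xor_dist: "accept_prob (xor_dist H A) G = accept_prob A (xor_pmf G H)"
proof -
  have "bind_pmf (xor_dist H A) (\<lambda>S. map_pmf (\<lambda>g. run_strat g S) G)
      = bind_pmf A (\<lambda>S. bind_pmf H (\<lambda>h. bind_pmf G (\<lambda>g. return_pmf (run_strat (\<lambda>x. xor (g x) (h x)) S))))"
    unfolding xor_dist_def map_pmf_def
    by (simp add: bind_assoc_pmf bind_return_pmf run_xor_strat)
  also have "\<dots> = bind_pmf A (\<lambda>S. bind_pmf G (\<lambda>g. bind_pmf H (\<lambda>h. return_pmf (run_strat (\<lambda>x. xor (g x) (h x)) S))))"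
    by (subst (2) bind_commute_pmf) (rule refl)
  also have "\<dots> = bind_pmf A (\<lambda>S. map_pmf (\<lambda>g. run_strat g S) (xor_pmf G H))"
    unfolding xor_pmf_def map_pmf_def pair_pmf_def
    by (simp add: bind_assoc_pmf bind_return_pmf)
  finally show ?thesis unfolding accept_prob_def by simp
qed

lemma accept_prob_eq:
  "accept_prob A G = (\<integral>S. measure_pmf.prob G {g. run_strat g S} \<partial>measure_pmf A)"
  unfolding accept_prob_def measure_pmf_single pmf_bind pmf_map by (simp add: vimage_def)

lemma adv_with_le_1: "adv_with A G0 G1 \<le> 1"
proof -
  have "0 \<le> accept_prob A G" "accept_prob A G \<le> 1" for G
    unfolding accept_prob_def by auto
  then show ?thesis unfolding adv_with_def by (smt (verit))
qed

lemma adv_with_le_adv: "is_distinguisher d m A \<Longrightarrow> adv_with A G0 G1 \<le> adv d m G0 G1"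
  unfolding adv_def
  by (rule cSUP_upper) (auto intro!: bdd_aboveI[of _ 1] adv_with_le_1)

lemma adv_leI:
  assumes "\<And>A. is_distinguisher d m A \<Longrightarrow> adv_with A G0 G1 \<le> B"
  shows "adv d m G0 G1 \<le> B"
proof -
  have "is_distinguisher d m (return_pmf (Out True))"
    by (auto simp: is_distinguisher_def intro: queries_le.intros)
  then show ?thesis unfolding adv_def using assms by (intro cSUP_least) auto
qed

lemma adv_le_1: "adv d m G0 G1 \<le> 1"
  by (intro adv_leI adv_with_le_1)

text \<open>The coins are averaged out, which leaves deterministic strategies.\<close>

lemma adv_le_of_strategies:
  assumes "\<And>S. queries_le d m S \<Longrightarrow>
    \<bar>measure_pmf.prob G0 {g. run_strat g S} - measure_pmf.prob G1 {g. run_strat g S}\<bar> \<le> B"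
  shows "adv d m G0 G1 \<le> B"
proof (rule adv_leI)
  fix A assume A: "is_distinguisher d m A"
  have int: "integrable (measure_pmf A) (\<lambda>S. measure_pmf.prob G {g. run_strat g S})" for G
    by (rule measure_pmf.integrable_const_bound[of _ 1]) auto
  have "accept_prob A G0 - accept_prob A G1 =
      (\<integral>S. measure_pmf.prob G0 {g. run_strat g S} - measure_pmf.prob G1 {g. run_strat g S} \<partial>measure_pmf A)"
    unfolding accept_prob_eq by (rule Bochner_Integration.integral_diff[symmetric]; rule int)
  also have "\<bar>\<dots>\<bar> \<le> (\<integral>S. \<bar>measure_pmf.prob G0 {g. run_strat g S} - measure_pmf.prob G1 {g. run_strat g S}\<bar> \<partial>measure_pmf A)"
    by (rule integral_abs_bound)
  also have "\<dots> \<le> (\<integral>S. B \<partial>measure_pmf A)"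
  proof (rule integral_mono_AE)
    show "AE S in measure_pmf A. \<bar>measure_pmf.prob G0 {g. run_strat g S} - measure_pmf.prob G1 {g. run_strat g S}\<bar> \<le> B"
      using A assms by (auto simp: AE_measure_pmf_iff is_distinguisher_def)
  qed (auto intro!: int)
  finally show "adv_with A G0 G1 \<le> B" by (simp add: adv_with_def)
qed

lemma pair_pmf_of_set:
  assumes "finite A" "A \<noteq> {}" "finite B" "B \<noteq> {}"
  shows "pair_pmf (pmf_of_set A) (pmf_of_set B) = pmf_of_set (A \<times> B)"
proof (rule pmf_eqI)
  fix z :: "'a \<times> 'b"
  show "pmf (pair_pmf (pmf_of_set A) (pmf_of_set B)) z = pmf (pmf_of_set (A \<times> B)) z"
    using assms by (cases z) (simp add: pmf_pair indicator_def card_cartesian_product)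
qed

lemma keyed_xor_eq: "keyed_xor k E = xor_pmf (keyed_E k E) (keyed_E k E)"
proof -
  have "pmf_of_set ({..<(2::nat) ^ k} \<times> {..<(2::nat) ^ k})
      = pair_pmf (pmf_of_set {..<2 ^ k}) (pmf_of_set {..<2 ^ k})"
    by (rule pair_pmf_of_set[symmetric]) (simp_all add: lessThan_empty_iff)
  then show ?thesis
    unfolding keyed_xor_def xor_pmf_def keyed_E_def map_pair[symmetric] pmf.map_comp
    by (simp add: o_def case_prod_unfold)
qed

lemma adv_prf_xor_le_hybrid:
  "adv_prf_xor k d E m \<le> 2 * adv_prp k d E m + adv d m (xor_pmf (rand_perm d) (rand_perm d)) (rand_fun d)"
  unfolding adv_prf_xor_def
proof (rule adv_leI)
  fix A assume A: "is_distinguisher d m A"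
  let ?K = "keyed_E k E" and ?P = "rand_perm d" and ?R = "rand_fun d"
  \<comment> \<open>The chain of laws is K + K, then P + K = K + P, then P + P;
    \<open>xor_dist\<close> supplies the summand that stays fixed in each move.\<close>
  have "adv_with (xor_dist ?K A) ?K ?P \<le> adv_prp k d E m" "adv_with (xor_dist ?P A) ?K ?P \<le> adv_prp k d E m"
    unfolding adv_prp_def by (intro adv_with_le_adv is_distinguisher_xor_dist A)+
  moreover have "adv_with A (xor_pmf ?P ?P) ?R \<le> adv d m (xor_pmf ?P ?P) ?R"
    by (intro adv_with_le_adv A)
  moreover have "xor_pmf ?P ?K = xor_pmf ?K ?P" by (rule xor_pmf_commute)
  ultimately show "adv_with A (keyed_xor k E) ?R \<le> 2 * adv_prp k d E m + adv d m (xor_pmf ?P ?P) ?R"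
    unfolding adv_with_def accept_prob_xor_dist keyed_xor_eq by simp
qed

section \<open>Adaptive strategies against exchangeable laws\<close>

lemma sum_lists_Suc:
  "(\<Sum>zs | set zs \<subseteq> A \<and> length zs = Suc n. f zs) = (\<Sum>y\<in>A. \<Sum>zs | set zs \<subseteq> A \<and> length zs = n. f (y # zs))"
proof -
  have "(\<Sum>zs | set zs \<subseteq> A \<and> length zs = Suc n. f zs)
      = (\<Sum>(y, zs)\<in>A \<times> {zs. set zs \<subseteq> A \<and> length zs = n}. f (y # zs))"
    by (rule sum.reindex_bij_witness[of _ "\<lambda>(y, zs). y # zs" "\<lambda>zs. (hd zs, tl zs)"])
       (auto simp: length_Suc_conv)
  then show ?thesis by (simp add: sum.cartesian_product)
qed

context xor_group
begin

text \<open>The first condition makes sums over answers in \<open>I\<close> exhaustive; the second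
  makes the law of the answers independent of which distinct points are queried.\<close>

definition exchangeable :: "(nat \<Rightarrow> nat) pmf \<Rightarrow> bool" where
  "exchangeable G \<longleftrightarrow> (\<forall>g\<in>set_pmf G. \<forall>x\<in>I. g x \<in> I) \<and> (\<forall>s. s permutes I \<longrightarrow> map_pmf (\<lambda>g. g \<circ> s) G = G)"

definition pt :: "(nat \<Rightarrow> nat) pmf \<Rightarrow> nat list \<Rightarrow> nat list \<Rightarrow> real" where
  "pt G xs ys = measure_pmf.prob G {g. map g xs = ys}"

text \<open>An enumeration of \<open>I\<close> that begins with \<open>xs\<close> is a permutation
  carrying the first positions to \<open>xs\<close>.\<close>

lemma exchangeable_pt:
  assumes G: "exchangeable G" and xs: "distinct xs" "set xs \<subseteq> I"
  shows "pt G xs ys = pt G [0..<length xs] ys"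
proof -
  define zs where "zs = xs @ sorted_list_of_set (I - set xs)"
  define s where "s i = (if i < N then zs ! i else i)" for i
  have "distinct zs" "set zs = I" using xs by (auto simp: zs_def)
  moreover from this have len: "length zs = N" by (metis card_lessThan distinct_card)
  ultimately have "bij_betw (\<lambda>i. zs ! i) I I" by (intro bij_betw_nth) auto
  then have "bij_betw s I I" by (subst bij_betw_cong[of _ _ "\<lambda>i. zs ! i"]) (auto simp: s_def)
  then have s: "s permutes I" by (rule bij_imp_permutes) (simp add: s_def)
  have lxs: "length xs \<le> N" using len by (simp add: zs_def)
  have "pt G [0..<length xs] ys = pt (map_pmf (\<lambda>g. g \<circ> s) G) [0..<length xs] ys"
    using G s by (simp add: exchangeable_def)
  also have "\<dots> = measure_pmf.prob G {g. map (g \<circ> s) [0..<length xs] = ys}"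
    unfolding pt_def measure_map_pmf by (simp add: vimage_def)
  also have "(\<lambda>g. map (g \<circ> s) [0..<length xs]) = (\<lambda>g. map g xs)"
  proof
    fix g
    show "map (g \<circ> s) [0..<length xs] = map g xs"
      using lxs by (intro nth_equalityI) (auto simp: s_def zs_def nth_append)
  qed
  finally show ?thesis by (simp add: pt_def)
qed

lemma prob_split:
  assumes G: "exchangeable G" and x: "x \<in> I"
  shows "measure_pmf.prob G {g. P g \<and> map g xs = ys}
    = (\<Sum>y\<in>I. measure_pmf.prob G {g. P g \<and> map g (xs @ [x]) = ys @ [y]})"
proof -
  have "measure_pmf.prob G {g. P g \<and> map g xs = ys}
      = measure_pmf.prob G ({g. P g \<and> map g xs = ys} \<inter> set_pmf G)"
    by (simp add: measure_Int_set_pmf)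
  also have "{g. P g \<and> map g xs = ys} \<inter> set_pmf G
      = (\<Union>y\<in>I. {g. P g \<and> map g (xs @ [x]) = ys @ [y]} \<inter> set_pmf G)"
    using G x by (auto simp: exchangeable_def)
  also have "measure_pmf.prob G \<dots> = (\<Sum>y\<in>I. measure_pmf.prob G ({g. P g \<and> map g (xs @ [x]) = ys @ [y]} \<inter> set_pmf G))"
    by (rule measure_pmf.finite_measure_finite_Union) (auto simp: disjoint_family_on_def)
  finally show ?thesis by (simp add: measure_Int_set_pmf)
qed

text \<open>Induction on the strategy, with the transcript \<open>xs\<close>, \<open>ys\<close> kept
  as a side event. An accepting leaf has difference \<open>r ys\<close>, a fresh query splits the
  event by its answer, and a repeated query is answered from the transcript, so that
  \<open>xs\<close> stays distinct. The right side does not depend on the strategy.\<close>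

lemma adaptive_le:
  assumes G: "exchangeable G0" "exchangeable G1"
  defines "r \<equiv> \<lambda>zs. pt G0 [0..<length zs] zs - pt G1 [0..<length zs] zs"
  shows "queries_le d n S \<Longrightarrow> distinct xs \<Longrightarrow> set xs \<subseteq> I \<Longrightarrow> length ys = length xs \<Longrightarrow> length xs + n \<le> N \<Longrightarrow>
    \<bar>measure_pmf.prob G0 {g. run_strat g S \<and> map g xs = ys} - measure_pmf.prob G1 {g. run_strat g S \<and> map g xs = ys}\<bar>
      \<le> (\<Sum>zs | set zs \<subseteq> I \<and> length zs = n. \<bar>r (ys @ zs)\<bar>)"
proof (induction S arbitrary: n xs ys)
  have step: "\<bar>r us\<bar> \<le> (\<Sum>y\<in>I. \<bar>r (us @ [y])\<bar>)" if "length us < N" for us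
  proof -
    have "pt G [0..<length us] us = (\<Sum>y\<in>I. pt G [0..<Suc (length us)] (us @ [y]))" if "exchangeable G" for G
      using prob_split[OF that, of "length us" "\<lambda>_. True"] \<open>length us < N\<close> by (simp add: pt_def)
    then have "r us = (\<Sum>y\<in>I. r (us @ [y]))"
      using G by (simp add: r_def sum_subtractf)
    then show ?thesis by simp
  qed
  \<comment> \<open>Forgetting the last answer cannot increase the l1 norm; this pads branches that
    stop early or repeat a query.\<close>
  have ext: "(\<Sum>zs | set zs \<subseteq> I \<and> length zs = n. \<bar>r (us @ zs)\<bar>) \<le> (\<Sum>zs | set zs \<subseteq> I \<and> length zs = Suc n. \<bar>r (us @ zs)\<bar>)"
    if "length us + Suc n \<le> N" for us n
    using that
  proof (induction n arbitrary: us)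
    case 0
    have "{zs. set zs \<subseteq> I \<and> length zs = 0} = {[]}" by auto
    then show ?case using step[of us] 0 by (simp only: sum_lists_Suc) simp
  next
    case (Suc n)
    have "(\<Sum>zs | set zs \<subseteq> I \<and> length zs = n. \<bar>r ((us @ [y]) @ zs)\<bar>) \<le> (\<Sum>zs | set zs \<subseteq> I \<and> length zs = Suc n. \<bar>r ((us @ [y]) @ zs)\<bar>)" for y
      using Suc.prems by (intro Suc.IH) simp
    then show ?case by (subst (1 2) sum_lists_Suc) (auto intro!: sum_mono)
  qed
  {
    case (Out b)
    show ?case
    proof (cases "b = True")
      case True
      have "\<bar>r ys\<bar> \<le> (\<Sum>zs | set zs \<subseteq> I \<and> length zs = n. \<bar>r (ys @ zs)\<bar>)"
        using Out.prems(5)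
      proof (induction n)
        case 0
        have "{zs. set zs \<subseteq> I \<and> length zs = 0} = {[]}" by auto
        then show ?case by (simp only:) simp
      next
        case (Suc n)
        then show ?case using ext[of ys n] Out.prems(4) by force
      qed
      moreover have "measure_pmf.prob G0 {g. map g xs = ys} - measure_pmf.prob G1 {g. map g xs = ys} = r ys"
        using exchangeable_pt[OF G(1) Out.prems(2,3), of ys] exchangeable_pt[OF G(2) Out.prems(2,3), of ys] Out.prems(4)
        by (simp add: r_def pt_def)
      ultimately show ?thesis using True by simp
    qed (simp add: sum_nonneg)
  next
    case (Query x c)
    from Query.prems(1) obtain n' where n: "n = Suc n'" and xN: "x < N" and cq: "\<And>y. queries_le d n' (c y)"
      by (cases rule: queries_le.cases) auto
    show ?case
    proof (cases "x \<in> set xs")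
      case True
      then obtain j where j: "j < length xs" "x = xs ! j" by (metis in_set_conv_nth)
      have ev: "{g. run_strat g (Query x c) \<and> map g xs = ys} = {g. run_strat g (c (ys ! j)) \<and> map g xs = ys}"
        using j by auto
      have "\<bar>measure_pmf.prob G0 {g. run_strat g (c (ys ! j)) \<and> map g xs = ys} - measure_pmf.prob G1 {g. run_strat g (c (ys ! j)) \<and> map g xs = ys}\<bar>
        \<le> (\<Sum>zs | set zs \<subseteq> I \<and> length zs = n'. \<bar>r (ys @ zs)\<bar>)"
        using Query.prems by (intro Query.IH[OF _ cq]) (auto simp: n)
      also have "\<dots> \<le> (\<Sum>zs | set zs \<subseteq> I \<and> length zs = n. \<bar>r (ys @ zs)\<bar>)"
        unfolding n using Query.prems by (intro ext) (auto simp: n)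
      finally show ?thesis unfolding ev .
    next
      case False
      have x: "x \<in> I" using xN by simp
      have pr: "measure_pmf.prob G {g. run_strat g (Query x c) \<and> map g xs = ys}
          = (\<Sum>y\<in>I. measure_pmf.prob G {g. run_strat g (c y) \<and> map g (xs @ [x]) = ys @ [y]})" if "exchangeable G" for G
      proof -
        have "{g. run_strat g (Query x c) \<and> map g (xs @ [x]) = ys @ [y]} = {g. run_strat g (c y) \<and> map g (xs @ [x]) = ys @ [y]}" for y
          using Query.prems(4) by auto
        then show ?thesis by (subst prob_split[OF that x]) simp
      qed
      have "\<bar>measure_pmf.prob G0 {g. run_strat g (Query x c) \<and> map g xs = ys} - measure_pmf.prob G1 {g. run_strat g (Query x c) \<and> map g xs = ys}\<bar>
        \<le> (\<Sum>y\<in>I. \<bar>measure_pmf.prob G0 {g. run_strat g (c y) \<and> map g (xs @ [x]) = ys @ [y]}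
             - measure_pmf.prob G1 {g. run_strat g (c y) \<and> map g (xs @ [x]) = ys @ [y]}\<bar>)"
        unfolding pr[OF G(1)] pr[OF G(2)] sum_subtractf[symmetric] by (rule sum_abs)
      also have "\<dots> \<le> (\<Sum>y\<in>I. \<Sum>zs | set zs \<subseteq> I \<and> length zs = n'. \<bar>r ((ys @ [y]) @ zs)\<bar>)"
        using Query.prems x False by (intro sum_mono Query.IH[OF _ cq]) (auto simp: n)
      also have "\<dots> = (\<Sum>zs | set zs \<subseteq> I \<and> length zs = n. \<bar>r (ys @ zs)\<bar>)"
        by (simp add: n sum_lists_Suc)
      finally show ?thesis .
    qed
  }
qed

lemma adv_le_l1:
  assumes G: "exchangeable G0" "exchangeable G1" and m: "m \<le> N"
  shows "adv d m G0 G1 \<le> (\<Sum>zs | set zs \<subseteq> I \<and> length zs = m. \<bar>pt G0 [0..<m] zs - pt G1 [0..<m] zs\<bar>)"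
proof (rule adv_le_of_strategies)
  fix S assume S: "queries_le d m S"
  have "(\<Sum>zs | set zs \<subseteq> I \<and> length zs = m. \<bar>pt G0 [0..<length zs] zs - pt G1 [0..<length zs] zs\<bar>)
      = (\<Sum>zs | set zs \<subseteq> I \<and> length zs = m. \<bar>pt G0 [0..<m] zs - pt G1 [0..<m] zs\<bar>)"
    by (intro sum.cong) auto
  with adaptive_le[OF G S, of "[]" "[]"] m
  show "\<bar>measure_pmf.prob G0 {g. run_strat g S} - measure_pmf.prob G1 {g. run_strat g S}\<bar>
      \<le> (\<Sum>zs | set zs \<subseteq> I \<and> length zs = m. \<bar>pt G0 [0..<m] zs - pt G1 [0..<m] zs\<bar>)"
    by simp
qed

end

section \<open>The advantage in terms of Fourier coefficients\<close>

lemma sum_lists_prod: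
  fixes f :: "nat \<Rightarrow> 'a \<Rightarrow> 'b :: comm_semiring_1"
  assumes "finite A"
  shows "(\<Sum>zs | set zs \<subseteq> A \<and> length zs = n. \<Prod>i<n. f i (zs ! i)) = (\<Prod>i<n. \<Sum>y\<in>A. f i y)"
proof (induction n arbitrary: f)
  case 0
  have "{zs. set zs \<subseteq> A \<and> length zs = 0} = {[]}" by auto
  then show ?case by (simp only:) simp
next
  case (Suc n)
  have "(\<Sum>zs | set zs \<subseteq> A \<and> length zs = Suc n. \<Prod>i<Suc n. f i (zs ! i))
      = (\<Sum>y\<in>A. \<Sum>zs | set zs \<subseteq> A \<and> length zs = n. f 0 y * (\<Prod>i<n. f (Suc i) (zs ! i)))"
    unfolding sum_lists_Suc prod.lessThan_Suc_shift by simp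
  also have "\<dots> = (\<Sum>y\<in>A. f 0 y * (\<Prod>i<n. \<Sum>z\<in>A. f (Suc i) z))"
    by (simp only: sum_distrib_left[symmetric] Suc.IH[of "\<lambda>i. f (Suc i)"])
  also have "\<dots> = (\<Prod>i<Suc n. \<Sum>y\<in>A. f i y)"
    unfolding prod.lessThan_Suc_shift by (simp add: sum_distrib_right)
  finally show ?case .
qed

lemma bij_betw_lists_PiE_dflt:
  "bij_betw (\<lambda>zs i. if i < n then zs ! i else z) {zs. set zs \<subseteq> A \<and> length zs = n} (PiE_dflt {..<n} z (\<lambda>_. A))"
proof (rule bij_betw_byWitness[where f' = "\<lambda>f. map f [0..<n]"])
  show "\<forall>zs\<in>{zs. set zs \<subseteq> A \<and> length zs = n}. map (\<lambda>i. if i < n then zs ! i else z) [0..<n] = zs"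
    by (auto intro: nth_equalityI)
  show "\<forall>f\<in>PiE_dflt {..<n} z (\<lambda>_. A). (\<lambda>i. if i < n then map f [0..<n] ! i else z) = f"
    by (auto simp: PiE_dflt_def fun_eq_iff)
qed (auto simp: PiE_dflt_def subset_iff)

context xor_group
begin

text \<open>\<open>M\<close> is an arbitrary set of points because the averaging in
  \<open>L_step\<close> removes points in the middle. The default 0 is the trivial character, as in
  the convention for \<open>hat\<close>.\<close>

definition L :: "nat set \<Rightarrow> real" where
  "L M = (\<Sum>a\<in>PiE_dflt M 0 (\<lambda>_. I) - {\<lambda>_. 0}. hat a ^ 4)"

lemma parseval_lists:
  fixes r :: "nat list \<Rightarrow> real"
  shows "real N ^ m * (\<Sum>zs | set zs \<subseteq> I \<and> length zs = m. (r zs)\<^sup>2)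
    = (\<Sum>a\<in>PiE_dflt {..<m} 0 (\<lambda>_. I). (\<Sum>zs | set zs \<subseteq> I \<and> length zs = m. r zs * (\<Prod>i<m. chi (a i) (zs ! i)))\<^sup>2)"
proof -
  define W where "W = {zs. set zs \<subseteq> I \<and> length zs = m}"
  have W: "(\<Sum>zs | set zs \<subseteq> I \<and> length zs = m. f zs) = (\<Sum>zs\<in>W. f zs)" for f :: "nat list \<Rightarrow> real"
    by (simp add: W_def)
  have ortho: "(\<Sum>as\<in>W. (\<Prod>i<m. chi (as ! i) (zs ! i)) * (\<Prod>i<m. chi (as ! i) (ys ! i)))
      = (if zs = ys then real N ^ m else 0)" if "zs \<in> W" "ys \<in> W" for zs ys
  proof -
    have "(\<Sum>as\<in>W. (\<Prod>i<m. chi (as ! i) (zs ! i)) * (\<Prod>i<m. chi (as ! i) (ys ! i)))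
        = (\<Prod>i<m. \<Sum>a\<in>I. chi a (zs ! i) * chi a (ys ! i))"
      unfolding W_def prod.distrib[symmetric] by (rule sum_lists_prod) simp
    also have "\<dots> = (\<Prod>i<m. if zs ! i = ys ! i then real N else 0)"
    proof (intro prod.cong refl)
      fix i assume i: "i \<in> {..<m}"
      have "zs ! i \<in> I" "ys ! i \<in> I"
        using that i nth_mem[of i zs] nth_mem[of i ys] by (auto simp: W_def simp del: nth_mem)
      from chi_orthogonal[OF this]
      show "(\<Sum>a\<in>I. chi a (zs ! i) * chi a (ys ! i)) = (if zs ! i = ys ! i then real N else 0)"
        by (simp add: chi_commute)
    qed
    also have "\<dots> = (if zs = ys then real N ^ m else 0)"
    proof (cases "zs = ys")
      case False
      moreover have "length zs = m" "length ys = m" using that by (auto simp: W_def)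
      ultimately obtain i where "i < m" "zs ! i \<noteq> ys ! i"
        by (metis nth_equalityI)
      then show ?thesis using False by (subst prod_zero) auto
    qed simp
    finally show ?thesis .
  qed
  have finW: "finite W" unfolding W_def by (rule finite_lists_length_eq) simp
  have "(\<Sum>a\<in>PiE_dflt {..<m} 0 (\<lambda>_. I). (\<Sum>zs\<in>W. r zs * (\<Prod>i<m. chi (a i) (zs ! i)))\<^sup>2)
      = (\<Sum>as\<in>W. (\<Sum>zs\<in>W. r zs * (\<Prod>i<m. chi (as ! i) (zs ! i)))\<^sup>2)"
    unfolding sum.reindex_bij_betw[OF bij_betw_lists_PiE_dflt, symmetric, of _ m 0 I] W_def[symmetric] by simp
  also have "\<dots> = (\<Sum>as\<in>W. \<Sum>zs\<in>W. \<Sum>ys\<in>W. r zs * r ys * ((\<Prod>i<m. chi (as ! i) (zs ! i)) * (\<Prod>i<m. chi (as ! i) (ys ! i))))"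
    unfolding power2_eq_square sum_product by (intro sum.cong refl) (simp only: mult_ac)
  also have "\<dots> = (\<Sum>zs\<in>W. \<Sum>ys\<in>W. \<Sum>as\<in>W. r zs * r ys * ((\<Prod>i<m. chi (as ! i) (zs ! i)) * (\<Prod>i<m. chi (as ! i) (ys ! i))))"
    by (subst sum.swap, rule sum.cong, rule refl, rule sum.swap)
  also have "\<dots> = (\<Sum>zs\<in>W. \<Sum>ys\<in>W. r zs * r ys * (if zs = ys then real N ^ m else 0))"
    by (intro sum.cong refl) (simp only: sum_distrib_left[symmetric] ortho)
  also have "\<dots> = (\<Sum>zs\<in>W. \<Sum>ys\<in>W. if zs = ys then r zs * r ys * real N ^ m else 0)"
    by (intro sum.cong refl) simp
  also have "\<dots> = (\<Sum>zs\<in>W. r zs * r zs * real N ^ m)"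
    using finW by (simp add: sum.delta)
  also have "\<dots> = real N ^ m * (\<Sum>zs\<in>W. (r zs)\<^sup>2)"
    by (simp add: sum_distrib_left power2_eq_square mult_ac)
  finally show ?thesis unfolding W ..
qed

lemma sum_pt:
  assumes "exchangeable G" "m \<le> N"
  shows "(\<Sum>zs | set zs \<subseteq> I \<and> length zs = m. pt G [0..<m] zs * F zs) = (\<integral>g. F (map g [0..<m]) \<partial>measure_pmf G)"
proof -
  have "(\<integral>g. F (map g [0..<m]) \<partial>measure_pmf G) = (\<integral>zs. F zs \<partial>measure_pmf (map_pmf (\<lambda>g. map g [0..<m]) G))"
    by simp
  also have "\<dots> = (\<Sum>zs | set zs \<subseteq> I \<and> length zs = m. F zs * pmf (map_pmf (\<lambda>g. map g [0..<m]) G) zs)"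
  proof (rule integral_measure_pmf_real)
    fix zs assume "zs \<in> set_pmf (map_pmf (\<lambda>g. map g [0..<m]) G)"
    then show "zs \<in> {zs. set zs \<subseteq> I \<and> length zs = m}"
      using assms by (auto simp: exchangeable_def)
  qed (rule finite_lists_length_eq, simp)
  also have "\<dots> = (\<Sum>zs | set zs \<subseteq> I \<and> length zs = m. pt G [0..<m] zs * F zs)"
    by (simp add: pt_def pmf_map vimage_def mult.commute)
  finally show ?thesis ..
qed

section \<open>The two ideal laws and their Fourier transforms\<close>

definition perms :: "(nat \<Rightarrow> nat) set" where
  "perms = {p \<in> I \<rightarrow>\<^sub>E I. bij_betw p I I}"

lemma rand_perm_eq: "rand_perm d = pmf_of_set perms"
  by (simp add: rand_perm_def perms_def)

lemma finite_restricted_perms [simp]: "finite perms"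
  unfolding perms_def by (rule finite_subset[of _ "I \<rightarrow>\<^sub>E I"]) (auto intro: finite_PiE)

text \<open>Bridges two conventions: \<open>rand_perm\<close> samples functions that are undefined
  off \<open>I\<close>, whereas \<open>hat\<close> sums over permutations that are the identity off
  \<open>I\<close>.\<close>

lemma bij_betw_perms: "bij_betw (\<lambda>p. restrict p I) {p. p permutes I} perms"
proof (rule bij_betw_byWitness[where f' = "\<lambda>p i. if i \<in> I then p i else i"])
  show "\<forall>p\<in>{p. p permutes I}. (\<lambda>i. if i \<in> I then restrict p I i else i) = p"
    by (auto simp: fun_eq_iff permutes_def)
  show "\<forall>p\<in>perms. restrict (\<lambda>i. if i \<in> I then p i else i) I = p"
    by (auto simp: perms_def fun_eq_iff PiE_def extensional_def)
  show "(\<lambda>p. restrict p I) ` {p. p permutes I} \<subseteq> perms"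
  proof clarify
    fix p assume p: "p permutes I"
    have "bij_betw (restrict p I) I I"
      using permutes_imp_bij[OF p] by (subst bij_betw_restrict_eq)
    moreover have "restrict p I \<in> I \<rightarrow>\<^sub>E I"
      using permutes_in_image[OF p] by (intro restrict_PiE_iff[THEN iffD2]) blast
    ultimately show "restrict p I \<in> perms" by (simp add: perms_def)
  qed
  show "(\<lambda>p i. if i \<in> I then p i else i) ` perms \<subseteq> {p. p permutes I}"
  proof clarify
    fix p assume "p \<in> perms"
    then have "bij_betw p I I" by (simp add: perms_def)
    then have "bij_betw (\<lambda>i. if i \<in> I then p i else i) I I"
      by (subst bij_betw_cong[of _ _ p]) auto
    then show "(\<lambda>i. if i \<in> I then p i else i) permutes I"
      by (rule bij_imp_permutes) simp
  qed
qed

lemma card_perms: "card perms = fact N"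
  using bij_betw_same_card[OF bij_betw_perms] by (simp add: card_permutations)

lemma perms_nonempty [simp]: "perms \<noteq> {}"
  using card_perms by (metis card.empty fact_nonzero)

lemma sum_perms: "(\<Sum>p\<in>perms. \<Prod>i\<in>I. chi (a i) (p i)) = fact N * hat a"
  unfolding sum.reindex_bij_betw[OF bij_betw_perms, symmetric] hat_def by simp

lemma perms_compose:
  assumes "s permutes I"
  shows "bij_betw (\<lambda>p. p \<circ> s) perms perms" "bij_betw (\<lambda>g. g \<circ> s) (I \<rightarrow>\<^sub>E I) (I \<rightarrow>\<^sub>E I)"
proof -
  have ext: "p \<circ> s \<in> I \<rightarrow>\<^sub>E I" if p: "p \<in> I \<rightarrow>\<^sub>E I" and s: "s permutes I" for p s
  proof (rule PiE_I)
    fix x assume "x \<in> I"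
    then have "s x \<in> I" using permutes_in_image[OF s] by blast
    then show "(p \<circ> s) x \<in> I" using p by auto
  next
    fix x assume "x \<notin> I"
    then show "(p \<circ> s) x = undefined"
      using s p by (simp add: permutes_not_in PiE_arb[OF p])
  qed
  have perm: "p \<circ> s \<in> perms" if p: "p \<in> perms" and s: "s permutes I" for p s
    using ext[OF _ s, of p] p bij_betw_trans[OF permutes_imp_bij[OF s], of p I] by (auto simp: perms_def)
  have inv: "p \<circ> s \<circ> inv s = p" "p \<circ> inv s \<circ> s = p" for p :: "nat \<Rightarrow> nat"
    by (simp_all add: o_assoc[symmetric] permutes_inv_o[OF assms])
  show "bij_betw (\<lambda>p. p \<circ> s) perms perms"
  proof (rule bij_betw_byWitness[where f' = "\<lambda>p. p \<circ> inv s"])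
    show "(\<lambda>p. p \<circ> s) ` perms \<subseteq> perms" using perm[OF _ assms] by blast
    show "(\<lambda>p. p \<circ> inv s) ` perms \<subseteq> perms" using perm[OF _ permutes_inv[OF assms]] by blast
  qed (simp_all only: inv, simp_all)
  show "bij_betw (\<lambda>g. g \<circ> s) (I \<rightarrow>\<^sub>E I) (I \<rightarrow>\<^sub>E I)"
  proof (rule bij_betw_byWitness[where f' = "\<lambda>p. p \<circ> inv s"])
    show "(\<lambda>p. p \<circ> s) ` (I \<rightarrow>\<^sub>E I) \<subseteq> I \<rightarrow>\<^sub>E I" using ext[OF _ assms] by blast
    show "(\<lambda>p. p \<circ> inv s) ` (I \<rightarrow>\<^sub>E I) \<subseteq> I \<rightarrow>\<^sub>E I" using ext[OF _ permutes_inv[OF assms]] by blast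
  qed (simp_all only: inv, simp_all)
qed

lemma funs_nonempty [simp]: "I \<rightarrow>\<^sub>E I \<noteq> {}" and finite_funs [simp]: "finite (I \<rightarrow>\<^sub>E I)"
  by (auto simp: PiE_eq_empty_iff lessThan_empty_iff intro: finite_PiE)

lemma exchangeable_rand_fun: "exchangeable (rand_fun d)"
  unfolding exchangeable_def
proof (intro conjI allI impI)
  show "\<forall>g\<in>set_pmf (rand_fun d). \<forall>x\<in>I. g x \<in> I"
    unfolding rand_fun_def by (subst set_pmf_of_set) (auto simp del: lessThan_iff)
  fix s assume "s permutes I"
  then show "map_pmf (\<lambda>g. g \<circ> s) (rand_fun d) = rand_fun d"
    unfolding rand_fun_def by (intro map_pmf_of_set_bij_betw perms_compose) simp_all
qed

lemma exchangeable_xor_perm: "exchangeable (xor_pmf (rand_perm d) (rand_perm d))"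
  unfolding exchangeable_def
proof (intro conjI allI impI)
  show "\<forall>g\<in>set_pmf (xor_pmf (rand_perm d) (rand_perm d)). \<forall>x\<in>I. g x \<in> I"
  proof (intro ballI)
    fix g x assume "g \<in> set_pmf (xor_pmf (rand_perm d) (rand_perm d))" and x: "x \<in> I"
    then obtain p q where "p \<in> perms" "q \<in> perms" and g: "g = (\<lambda>x. xor (p x) (q x))"
      unfolding xor_pmf_def rand_perm_eq by auto
    then have "p x \<in> I" "q x \<in> I" using x unfolding perms_def by (blast dest: PiE_mem)+
    then show "g x \<in> I" unfolding g by (auto intro: xor_less)
  qed
  fix s assume s: "s permutes I"
  have "map_pmf (\<lambda>g. g \<circ> s) (xor_pmf (rand_perm d) (rand_perm d))
      = xor_pmf (map_pmf (\<lambda>g. g \<circ> s) (rand_perm d)) (map_pmf (\<lambda>g. g \<circ> s) (rand_perm d))"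
    unfolding xor_pmf_def map_pair[symmetric] pmf.map_comp
    by (simp add: o_def case_prod_unfold)
  also have "map_pmf (\<lambda>g. g \<circ> s) (rand_perm d) = rand_perm d"
    unfolding rand_perm_eq using s by (intro map_pmf_of_set_bij_betw perms_compose) simp_all
  finally show "map_pmf (\<lambda>g. g \<circ> s) (xor_pmf (rand_perm d) (rand_perm d)) = xor_pmf (rand_perm d) (rand_perm d)" .
qed

lemma prod_chi_support:
  assumes "a \<in> PiE_dflt {..<m} 0 (\<lambda>_. I)" "m \<le> N"
  shows "(\<Prod>i<m. chi (a i) (g i)) = (\<Prod>i\<in>I. chi (a i) (g i))"
  by (rule prod.mono_neutral_left) (use assms in \<open>auto simp: PiE_dflt_def\<close>)

text \<open>The xor of independent samples multiplies transforms, whence the square here and the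
  fourth powers in \<open>L\<close>.\<close>

lemma fourier_xor_perm:
  assumes a: "a \<in> PiE_dflt {..<m} 0 (\<lambda>_. I)" and m: "m \<le> N"
  shows "(\<integral>g. (\<Prod>i<m. chi (a i) (g i)) \<partial>measure_pmf (xor_pmf (rand_perm d) (rand_perm d))) = (hat a)\<^sup>2"
proof -
  have "(\<integral>g. (\<Prod>i<m. chi (a i) (g i)) \<partial>measure_pmf (xor_pmf (rand_perm d) (rand_perm d)))
      = (\<integral>(p, q). (\<Prod>i\<in>I. chi (a i) (p i)) * (\<Prod>i\<in>I. chi (a i) (q i)) \<partial>measure_pmf (pmf_of_set (perms \<times> perms)))"
    unfolding xor_pmf_def rand_perm_eq prod_chi_support[OF a m]
    by (simp add: pair_pmf_of_set case_prod_unfold chi_xor_right prod.distrib)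
  also have "\<dots> = (\<Sum>(p, q)\<in>perms \<times> perms. (\<Prod>i\<in>I. chi (a i) (p i)) * (\<Prod>i\<in>I. chi (a i) (q i))) / (fact N * fact N)"
    by (subst integral_pmf_of_set) (auto simp: card_cartesian_product card_perms)
  also have "\<dots> = ((\<Sum>p\<in>perms. \<Prod>i\<in>I. chi (a i) (p i)) * (\<Sum>p\<in>perms. \<Prod>i\<in>I. chi (a i) (p i))) / (fact N * fact N)"
    by (simp add: sum_product sum.cartesian_product)
  also have "\<dots> = (hat a)\<^sup>2"
    unfolding sum_perms by (simp add: power2_eq_square)
  finally show ?thesis .
qed

lemma fourier_rand_fun:
  assumes a: "a \<in> PiE_dflt {..<m} 0 (\<lambda>_. I)" and m: "m \<le> N"
  shows "(\<integral>g. (\<Prod>i<m. chi (a i) (g i)) \<partial>measure_pmf (rand_fun d)) = (if a = (\<lambda>_. 0) then 1 else 0)"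
proof (cases "a = (\<lambda>_. 0)")
  case False
  then obtain i where i: "a i \<noteq> 0" by (auto simp: fun_eq_iff)
  have "i < m" by (rule ccontr) (use a i in \<open>auto simp: PiE_dflt_def\<close>)
  then have iI: "i \<in> I" "a i \<in> I" using a m by (auto simp: PiE_dflt_def)
  have "(\<Sum>g\<in>I \<rightarrow>\<^sub>E I. \<Prod>i\<in>I. chi (a i) (g i)) = (\<Prod>i\<in>I. \<Sum>y\<in>I. chi (a i) y)"
    by (rule prod_sum_PiE[symmetric]) auto
  also have "\<dots> = 0" using i iI sum_chi[OF iI(2)] by (intro prod_zero) auto
  finally have "(\<integral>g. (\<Prod>i\<in>I. chi (a i) (g i)) \<partial>measure_pmf (rand_fun d)) = 0"
    unfolding rand_fun_def by (subst integral_pmf_of_set) auto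
  then show ?thesis using False by (simp add: prod_chi_support[OF a m])
qed simp

lemma adv_xor_perm_le:
  assumes m: "m \<le> N"
  shows "adv d m (xor_pmf (rand_perm d) (rand_perm d)) (rand_fun d) \<le> sqrt (L {..<m})"
proof -
  let ?G = "xor_pmf (rand_perm d) (rand_perm d)" and ?R = "rand_fun d"
  let ?W = "{zs. set zs \<subseteq> I \<and> length zs = m}"
  define r where "r zs = pt ?G [0..<m] zs - pt ?R [0..<m] zs" for zs
  \<comment> \<open>Cauchy-Schwarz over the N^m transcripts; the factor N^m is exactly the one in
    Parseval's identity.\<close>
  have "(\<Sum>zs\<in>?W. \<bar>r zs\<bar>)\<^sup>2 \<le> (\<Sum>zs\<in>?W. \<bar>r zs\<bar>\<^sup>2) * real (card ?W)"
    by (rule sum_squared_le_sum_of_squares)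
  also have "\<dots> = real N ^ m * (\<Sum>zs\<in>?W. (r zs)\<^sup>2)"
    by (simp add: card_lists_length_eq)
  also have "\<dots> = (\<Sum>a\<in>PiE_dflt {..<m} 0 (\<lambda>_. I). (\<Sum>zs\<in>?W. r zs * (\<Prod>i<m. chi (a i) (zs ! i)))\<^sup>2)"
    by (rule parseval_lists)
  also have "\<dots> = (\<Sum>a\<in>PiE_dflt {..<m} 0 (\<lambda>_. I). ((hat a)\<^sup>2 - (if a = (\<lambda>_. 0) then 1 else 0))\<^sup>2)"
  proof (intro sum.cong refl)
    fix a assume a: "a \<in> PiE_dflt {..<m} 0 (\<lambda>_. I)"
    have F: "(\<Sum>zs\<in>?W. pt G [0..<m] zs * (\<Prod>i<m. chi (a i) (zs ! i))) = (\<integral>g. (\<Prod>i<m. chi (a i) (g i)) \<partial>measure_pmf G)"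
      if "exchangeable G" for G
      using sum_pt[OF that m, of "\<lambda>zs. \<Prod>i<m. chi (a i) (zs ! i)"] by simp
    show "(\<Sum>zs\<in>?W. r zs * (\<Prod>i<m. chi (a i) (zs ! i)))\<^sup>2 = ((hat a)\<^sup>2 - (if a = (\<lambda>_. 0) then 1 else 0))\<^sup>2"
      by (simp only: r_def left_diff_distrib sum_subtractf F[OF exchangeable_xor_perm] F[OF exchangeable_rand_fun]
          fourier_xor_perm[OF a m] fourier_rand_fun[OF a m])
  qed
  \<comment> \<open>At the trivial character both transforms are 1 and cancel; at every other one
    the transform of the random function has vanished.\<close>
  also have "\<dots> = L {..<m}"
    unfolding L_def
    by (rule sum.mono_neutral_cong_right) (auto simp: hat_const_zero power_mult[symmetric] intro!: finite_PiE_dflt)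
  finally have "(\<Sum>zs\<in>?W. \<bar>r zs\<bar>) \<le> sqrt (L {..<m})" by (rule real_le_rsqrt)
  moreover have "adv d m ?G ?R \<le> (\<Sum>zs\<in>?W. \<bar>r zs\<bar>)"
    unfolding r_def by (intro adv_le_l1 exchangeable_xor_perm exchangeable_rand_fun m)
  ultimately show ?thesis by simp
qed

end

section \<open>Reduction to all but one query\<close>

context xor_group
begin

lemma L_nonneg: "0 \<le> L M"
  unfolding L_def by (intro sum_nonneg) auto

lemma finite_PiE_dflt_I [simp]: "finite M \<Longrightarrow> finite (PiE_dflt M 0 (\<lambda>_. I))"
  by (rule finite_PiE_dflt) auto

lemma L_image_perm:
  assumes s: "s permutes I" and M: "M \<subseteq> I"
  shows "L (s ` M) = L M"
  unfolding L_def
proof (rule sum.reindex_bij_witness[of _ "\<lambda>a. a \<circ> inv s" "\<lambda>a. a \<circ> s"])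
  note inj = permutes_inj[OF s] and o = permutes_inv_o[OF s]
  fix a assume a: "a \<in> PiE_dflt (s ` M) 0 (\<lambda>_. I) - {\<lambda>_. 0}"
  show as: "a \<circ> s \<circ> inv s = a" by (simp add: o_assoc[symmetric] o)
  have "a \<circ> s \<noteq> (\<lambda>_. 0)"
  proof
    assume "a \<circ> s = (\<lambda>_. 0)"
    then have "a \<circ> s \<circ> inv s = (\<lambda>_. 0)" by (simp only: o_def)
    with as have "a = (\<lambda>_. 0)" by (simp only:)
    then show False using a by blast
  qed
  moreover have "a \<circ> s \<in> PiE_dflt M 0 (\<lambda>_. I)"
    using a inj by (auto simp: PiE_dflt_def inj_image_mem_iff)
  ultimately show "a \<circ> s \<in> PiE_dflt M 0 (\<lambda>_. I) - {\<lambda>_. 0}" by blast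
  show "hat (a \<circ> s) ^ 4 = hat a ^ 4" by (simp only: hat_comp_perm[OF s])
next
  note inj = permutes_inj[OF s] and o = permutes_inv_o[OF s]
  fix a assume a: "a \<in> PiE_dflt M 0 (\<lambda>_. I) - {\<lambda>_. 0}"
  show as: "a \<circ> inv s \<circ> s = a" by (simp add: o_assoc[symmetric] o)
  have "a \<circ> inv s \<noteq> (\<lambda>_. 0)"
  proof
    assume "a \<circ> inv s = (\<lambda>_. 0)"
    then have "a \<circ> inv s \<circ> s = (\<lambda>_. 0)" by (simp only: o_def)
    with as have "a = (\<lambda>_. 0)" by (simp only:)
    then show False using a by blast
  qed
  moreover have "a \<circ> inv s \<in> PiE_dflt (s ` M) 0 (\<lambda>_. I)"
  proof -
    have "inv s x \<in> M \<longleftrightarrow> x \<in> s ` M" for x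
      by (auto simp: permutes_inverses[OF s] image_iff intro!: bexI[of _ "inv s x"])
    then show ?thesis using a by (auto simp: PiE_dflt_def)
  qed
  ultimately show "a \<circ> inv s \<in> PiE_dflt (s ` M) 0 (\<lambda>_. I) - {\<lambda>_. 0}" by blast
qed

lemma L_remove:
  assumes j: "j \<le> m" and m: "m < N"
  shows "L ({..m} - {j}) = L {..<m}"
proof -
  have "Transposition.transpose j m permutes I"
    using assms by (intro permutes_swap_id) auto
  moreover have "Transposition.transpose j m ` {..<m} = {..m} - {j}"
  proof (cases "j = m")
    case False
    then have "{..<m} = insert j ({..<m} - {j})" using j by auto
    then have "Transposition.transpose j m ` {..<m} = insert m (Transposition.transpose j m ` ({..<m} - {j}))"
      using image_insert[of "Transposition.transpose j m" j "{..<m} - {j}"] by simp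
    also have "Transposition.transpose j m ` ({..<m} - {j}) = {..<m} - {j}"
      by (rule trans[OF image_cong[OF refl, of _ _ "\<lambda>x. x"]]) (auto simp: Transposition.transpose_def)
    also have "insert m ({..<m} - {j}) = {..m} - {j}" using False by auto
    finally show ?thesis .
  qed (auto simp: lessThan_def atMost_def)
  ultimately show ?thesis using L_image_perm[of "Transposition.transpose j m" "{..<m}"] m by auto
qed

lemma PiE_dflt_remove:
  assumes "j \<in> M" "z \<in> A"
  shows "PiE_dflt (M - {j}) z (\<lambda>_. A) = {a \<in> PiE_dflt M z (\<lambda>_. A). a j = z}"
proof (rule set_eqI, rule iffI)
  fix a assume a: "a \<in> PiE_dflt (M - {j}) z (\<lambda>_. A)"
  have "a j = z" using a by (simp add: PiE_dflt_def)
  moreover have "a x \<in> A" if "x \<in> M" for x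
    using a that assms \<open>a j = z\<close> by (cases "x = j") (simp_all add: PiE_dflt_def)
  ultimately show "a \<in> {a \<in> PiE_dflt M z (\<lambda>_. A). a j = z}"
    using a by (simp add: PiE_dflt_def)
next
  fix a assume "a \<in> {a \<in> PiE_dflt M z (\<lambda>_. A). a j = z}"
  then show "a \<in> PiE_dflt (M - {j}) z (\<lambda>_. A)" by (auto simp: PiE_dflt_def)
qed

text \<open>Averages over the removed point: a character of support \<open>w\<close> survives the removal of
  \<open>m + 1 - w\<close> of the points, and \<open>w = 1\<close> does not contribute.\<close>

lemma L_step:
  assumes m: "m < N"
  shows "real (m + 1) * L {..<m} \<le> (real m - 1) * L {..<Suc m}"
proof -
  let ?P = "PiE_dflt {..m} 0 (\<lambda>_. I) - {\<lambda>_. 0}"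
  have fin: "finite ?P" by (intro finite_Diff finite_PiE_dflt_I finite_atMost)
  have "(\<Sum>j\<le>m. L ({..m} - {j})) = (\<Sum>j\<le>m. L {..<m})"
    by (intro sum.cong refl L_remove m) auto
  then have "real (m + 1) * L {..<m} = (\<Sum>j\<le>m. L ({..m} - {j}))"
    by simp
  also have "\<dots> = (\<Sum>j\<le>m. \<Sum>a\<in>?P. if a j = 0 then hat a ^ 4 else 0)"
  proof (intro sum.cong refl)
    fix j assume "j \<in> {..m}"
    then have "PiE_dflt ({..m} - {j}) 0 (\<lambda>_. I) - {\<lambda>_. 0} = {a \<in> ?P. a j = 0}"
      by (subst PiE_dflt_remove) auto
    then show "L ({..m} - {j}) = (\<Sum>a\<in>?P. if a j = 0 then hat a ^ 4 else 0)"
      unfolding L_def using sum.inter_filter[OF fin, of "\<lambda>a. hat a ^ 4" "\<lambda>a. a j = 0"] by (simp only:)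
  qed
  also have "\<dots> = (\<Sum>a\<in>?P. \<Sum>j\<le>m. if a j = 0 then hat a ^ 4 else 0)"
    by (rule sum.swap)
  also have "\<dots> \<le> (\<Sum>a\<in>?P. (real m - 1) * hat a ^ 4)"
  proof (rule sum_mono)
    fix a assume a: "a \<in> ?P"
    show "(\<Sum>j\<le>m. if a j = 0 then hat a ^ 4 else 0) \<le> (real m - 1) * hat a ^ 4"
    proof (cases "hat a = 0")
      case False
      obtain j where j: "a j \<noteq> 0" using a by (auto simp: fun_eq_iff)
      have supp: "i \<le> m" if "a i \<noteq> 0" for i
        by (rule ccontr) (use that a in \<open>auto simp: PiE_dflt_def\<close>)
      have "\<exists>i. i \<noteq> j \<and> a i \<noteq> 0"
      proof (rule ccontr)
        assume "\<not> ?thesis"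
        then have "hat a = 0" using j supp[OF j] a m by (intro hat_single[of j]) (auto simp: PiE_dflt_def)
        then show False using False by simp
      qed
      then obtain i where i: "i \<noteq> j" "a i \<noteq> 0" by blast
      have "card {k\<in>{..m}. a k = 0} \<le> card ({..m} - {i, j})"
        using i j by (intro card_mono) auto
      also have "card ({..m} - {i, j}) = card {..m} - card {i, j}"
        using supp[OF j] supp[OF i(2)] by (intro card_Diff_subset) auto
      finally have "card {k\<in>{..m}. a k = 0} \<le> m - 1" using i by simp
      moreover have "m \<ge> 1" using supp[OF j] supp[OF i(2)] i(1) by linarith
      ultimately have "real (card {k\<in>{..m}. a k = 0}) \<le> real m - 1" by linarith
      then have "real (card {k\<in>{..m}. a k = 0}) * hat a ^ 4 \<le> (real m - 1) * hat a ^ 4"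
        by (rule mult_right_mono) simp
      moreover have "(\<Sum>j\<le>m. if a j = 0 then hat a ^ 4 else 0) = real (card {k\<in>{..m}. a k = 0}) * hat a ^ 4"
        by (simp add: sum.inter_filter[symmetric])
      ultimately show ?thesis by simp
    next
      case True
      then have "(\<Sum>j\<le>m. if a j = 0 then hat a ^ 4 else 0) = 0" by (intro sum.neutral) simp
      then show ?thesis using True by simp
    qed
  qed
  also have "\<dots> = (real m - 1) * L {..<Suc m}"
    by (simp add: L_def sum_distrib_left lessThan_Suc_atMost)
  finally show ?thesis .
qed

text \<open>At m = 1 the factor \<open>real m - 1\<close> in \<open>L_step\<close> is 0. The case
  \<open>N = 1\<close> is separate because \<open>L_step\<close> requires m < N; there only the
  trivial character exists.\<close>

lemma L_small: "m \<le> 1 \<Longrightarrow> L {..<m} = 0"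
proof -
  have L1: "L {..<1} = 0"
  proof (cases "N = 1")
    case True
    have "PiE_dflt {..<1::nat} 0 (\<lambda>_. I) = {\<lambda>_. 0}"
      using True by (auto simp: PiE_dflt_def fun_eq_iff)
    then show ?thesis by (simp only: L_def Diff_cancel sum.empty)
  next
    case False
    then have "1 < N" using one_le_power[of "2::nat" d] by linarith
    from L_step[OF this] have "L {..<1} \<le> 0" by simp
    then show ?thesis using L_nonneg by (simp add: antisym)
  qed
  have "L {} = 0"
  proof -
    have "PiE_dflt ({} :: nat set) 0 (\<lambda>_. I) = {\<lambda>_. 0}" by (auto simp: PiE_dflt_def fun_eq_iff)
    then show ?thesis by (simp add: L_def)
  qed
  then show "m \<le> 1 \<Longrightarrow> L {..<m} = 0" using L1 by (cases "m = 0") (auto simp: le_Suc_eq)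
qed

text \<open>\<open>L_step\<close> says that L_m / (m (m - 1)) does not decrease with m, and the
  steps telescope. Clearing denominators keeps the cases m <= 1 meaningful.\<close>

lemma L_mono_weighted:
  assumes "m \<le> n" "n \<le> N"
  shows "L {..<m} * (real n * (real n - 1)) \<le> (real m * (real m - 1)) * L {..<n}"
proof (cases "m \<le> 1")
  case True
  then have "real m * (real m - 1) = 0" by (cases m) auto
  then show ?thesis by (simp only: L_small[OF True] mult_zero_left)
next
  case False
  show ?thesis using assms
  proof (induction n rule: dec_induct)
    case base
    then show ?case by simp
  next
    case (step n)
    have n: "real n > 1" using step False by simp
    have "L {..<m} * (real n * (real n - 1)) * real (n + 1) \<le> (real m * (real m - 1)) * L {..<n} * real (n + 1)"
      using step by (intro mult_right_mono) auto
    also have "\<dots> = (real m * (real m - 1)) * (real (n + 1) * L {..<n})" by simp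
    also have "\<dots> \<le> (real m * (real m - 1)) * ((real n - 1) * L {..<Suc n})"
      using step False by (intro mult_left_mono L_step) auto
    finally have "(real n - 1) * (L {..<m} * (real (Suc n) * (real (Suc n) - 1)))
        \<le> (real n - 1) * ((real m * (real m - 1)) * L {..<Suc n})"
      by (simp add: algebra_simps)
    then show ?case using n by (subst (asm) mult_le_cancel_left_pos) auto
  qed
qed

lemma L_le_L_pred:
  assumes m: "m < N" and N: "N \<ge> 4"
  shows "L {..<m} \<le> 4 * (real m)\<^sup>2 / (real N)\<^sup>2 * L {..<N - 1}"
proof -
  have "4 * ((real N - 1) * (real N - 2)) - (real N)\<^sup>2 = 3 * (real N - 4) * real N + 8"
    by (simp add: power2_eq_square algebra_simps)
  moreover have "4 \<le> real N" using of_nat_mono[OF N, where 'a = real] by simp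
  then have "0 \<le> 3 * (real N - 4) * real N"
    by (intro mult_nonneg_nonneg) auto
  ultimately have q: "(real N)\<^sup>2 / 4 \<le> (real N - 1) * (real N - 2)" by linarith
  have "L {..<m} * ((real N)\<^sup>2 / 4) \<le> L {..<m} * ((real N - 1) * (real N - 2))"
    by (intro mult_left_mono q L_nonneg)
  also have "\<dots> \<le> (real m * (real m - 1)) * L {..<N - 1}"
    using L_mono_weighted[of m "N - 1"] m by (simp add: of_nat_diff)
  also have "\<dots> \<le> (real m)\<^sup>2 * L {..<N - 1}"
    by (intro mult_right_mono L_nonneg) (simp add: power2_eq_square mult_left_mono)
  finally show ?thesis by (simp add: field_simps)
qed

text \<open>The multiplicities of the characters that remain after the most frequent value has been
  translated to \<open>0\<close>; the last condition is necessary for a nonzero Fourier coefficient.\<close>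

definition \<A> :: "nat multiset set" where
  "\<A> = {A. size A = N \<and> set_mset A \<subseteq> I \<and> (\<forall>g\<in>I. count A g \<le> count A 0) \<and> count A 0 \<noteq> N
    \<and> (\<forall>y\<in>I. (\<Prod>g\<in>I. chi g y ^ count A g) = 1)}"

lemma count_image_mset_I: "count (image_mset b (mset_set I)) g = card {i\<in>I. b i = g}"
  by (simp add: count_image_mset' eq_commute[of g])

lemma finite_A: "finite \<A>"
proof (rule finite_subset)
  show "\<A> \<subseteq> {A. size A = N \<and> set_mset A \<subseteq> I}" by (auto simp: \<A>_def)
  show "finite {A. size A = N \<and> set_mset A \<subseteq> I}"
    using finite_multisets_of_size[of I N] by (simp add: multisets_of_size_def conj_commute)
qed

text \<open>Translating by the most frequent value makes that value \<open>0\<close>; the translation can be undone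
  because the last coordinate was \<open>0\<close>.\<close>

lemma L_pred_le: "L {..<N - 1} \<le> (\<Sum>A\<in>\<A>. \<Sum>b\<in>orbit A. hat b ^ 4)"
proof -
  let ?P = "PiE_dflt {..<N - 1} 0 (\<lambda>_. I) - {\<lambda>_. 0}"
  define cnt where "cnt a g = card {i\<in>I. a i = g}" for a :: "nat \<Rightarrow> nat" and g
  define mode where "mode a = (SOME g. g \<in> I \<and> (\<forall>h\<in>I. cnt a h \<le> cnt a g))" for a
  define \<Phi> where "\<Phi> a = restrict (\<lambda>i. xor (a i) (mode a)) I" for a
  define B where "B = (\<Union>A\<in>\<A>. orbit A)"
  have mode: "mode a \<in> I" "\<And>h. h \<in> I \<Longrightarrow> cnt a h \<le> cnt a (mode a)" for a
  proof -
    have "Max (cnt a ` I) \<in> cnt a ` I"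
      by (rule Max_in) (auto simp: lessThan_empty_iff)
    then obtain g where "g \<in> I" "Max (cnt a ` I) = cnt a g" by blast
    then have "\<exists>g. g \<in> I \<and> (\<forall>h\<in>I. cnt a h \<le> cnt a g)"
      using Max_ge[of "cnt a ` I"] by force
    from someI_ex[OF this] show "mode a \<in> I" "\<And>h. h \<in> I \<Longrightarrow> cnt a h \<le> cnt a (mode a)"
      unfolding mode_def by blast+
  qed
  have Nm: "N - 1 \<in> I" by simp
  have hatPhi: "hat (\<Phi> a) ^ 4 = hat a ^ 4" for a
  proof -
    have "hat (\<Phi> a) = hat (\<lambda>i. xor (a i) (mode a))"
      by (rule hat_cong) (simp add: \<Phi>_def)
    then show ?thesis by (simp add: hat_xor_pow4)
  qed
  have inj: "inj_on \<Phi> ?P"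
  proof (rule inj_onI)
    fix a b assume a: "a \<in> ?P" and b: "b \<in> ?P" and eq: "\<Phi> a = \<Phi> b"
    have eq': "xor (a i) (mode a) = xor (b i) (mode b)" if "i \<in> I" for i
      using fun_cong[OF eq, of i] that by (simp add: \<Phi>_def)
    have "a (N - 1) = 0" "b (N - 1) = 0" using a b by (auto simp: PiE_dflt_def)
    then have "mode a = mode b" using eq'[OF Nm] by simp
    then have "a i = b i" if "i \<in> I" for i using eq'[OF that] by simp
    moreover have "a i = b i" if "i \<notin> I" for i
    proof -
      have "i \<notin> {..<N - 1}" using that by auto
      then show ?thesis using a b by (auto simp: PiE_dflt_def)
    qed
    ultimately show "a = b" by blast
  qed
  have memB: "\<Phi> a \<in> B" if a: "a \<in> ?P" and nz: "hat a \<noteq> 0" for a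
  proof -
    let ?b = "\<Phi> a"
    let ?A = "image_mset ?b (mset_set I)"
    have aI: "a i < N" for i using a by (cases "i < N - 1") (auto simp: PiE_dflt_def)
    have mI: "mode a < N" using mode(1)[of a] by simp
    have bI: "?b \<in> I \<rightarrow>\<^sub>E I" unfolding \<Phi>_def using aI mI by (auto intro: xor_less)
    have cA: "count ?A g = cnt a (xor g (mode a))" for g
    proof -
      have "xor (a i) (mode a) = g \<longleftrightarrow> a i = xor g (mode a)" for i
        by (metis xor_cancel)
      then have "{i\<in>I. \<Phi> a i = g} = {i\<in>I. a i = xor g (mode a)}"
        by (intro Collect_cong conj_cong refl) (simp add: \<Phi>_def)
      then show ?thesis unfolding count_image_mset_I cnt_def by (rule arg_cong)
    qed
    have "count ?A g \<le> count ?A 0" if "g \<in> I" for g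
      unfolding cA using mode(2)[of "xor g (mode a)" a] that mI by (auto intro: xor_less)
    moreover have "count ?A 0 \<noteq> N"
    proof
      assume "count ?A 0 = N"
      then have "card {i\<in>I. a i = mode a} = card I" by (simp add: cA cnt_def)
      then have "{i\<in>I. a i = mode a} = I" by (intro card_subset_eq) auto
      then have am: "a i = mode a" if "i \<in> I" for i using that by blast
      moreover have "a (N - 1) = 0" using a by (auto simp: PiE_dflt_def)
      ultimately have "mode a = 0" using am[OF Nm] by simp
      then have "a i = 0" for i using am[of i] a by (cases "i \<in> I") (auto simp: PiE_dflt_def)
      then have "a = (\<lambda>_. 0)" by blast
      then show False using a by simp
    qed
    moreover have "(\<Prod>g\<in>I. chi g y ^ count ?A g) = 1" if "y \<in> I" for y
    proof -
      have "hat ?b \<noteq> 0" using hatPhi[of a] nz by auto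
      from hat_nonzero_imp[OF this that] show ?thesis
        using bI by (subst (asm) prod_image_mset_set[of I I ?b "\<lambda>g. chi g y"]) auto
    qed
    ultimately have "?A \<in> \<A>" using bI by (auto simp: \<A>_def)
    then show ?thesis unfolding B_def using bI by (intro UN_I[of ?A]) (auto simp: orbit_def)
  qed
  have finB: "finite B" unfolding B_def using finite_A by simp
  \<comment> \<open>Only nonvanishing coefficients are kept, so that the condition on the characters
    in \<open>\<A>\<close> is available.\<close>
  have "L {..<N - 1} = (\<Sum>a\<in>{a\<in>?P. hat a \<noteq> 0}. hat (\<Phi> a) ^ 4)"
    unfolding L_def hatPhi by (rule sum.mono_neutral_right) auto
  also have "\<dots> = (\<Sum>b\<in>\<Phi> ` {a\<in>?P. hat a \<noteq> 0}. hat b ^ 4)"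
    by (subst sum.reindex) (auto intro: inj_on_subset[OF inj])
  also have "\<dots> \<le> (\<Sum>b\<in>B. hat b ^ 4)"
    using memB finB by (intro sum_mono2) auto
  also have "\<dots> = (\<Sum>A\<in>\<A>. \<Sum>b\<in>orbit A. hat b ^ 4)"
    unfolding B_def by (rule sum.UNION_disjoint) (auto simp: finite_A orbit_def)
  finally show ?thesis .
qed

end

section \<open>Summation over the multiplicities\<close>

lemma sum_power_fact_le_exp:
  fixes x :: real
  assumes "0 \<le> x" "finite S"
  shows "(\<Sum>k\<in>S. x ^ k / fact k) \<le> exp x"
proof -
  have "(\<Sum>k\<in>S. x ^ k /\<^sub>R fact k) \<le> (\<Sum>k. x ^ k /\<^sub>R fact k)"
    using assms by (intro sum_le_suminf summable_exp_generic) auto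
  then show ?thesis by (simp add: exp_def divide_inverse mult.commute)
qed

context xor_group
begin

abbreviation J :: "nat set" where "J \<equiv> {1..<2 ^ d}"

lemma I_eq: "I = insert 0 J"
  by (auto simp: not_less_eq_eq)

lemma size_eq_count_sum:
  assumes "set_mset A \<subseteq> I"
  shows "size A = count A 0 + (\<Sum>g\<in>J. count A g)"
proof -
  have "size A = (\<Sum>g\<in>set_mset A. count A g)" by (rule size_multiset_overloaded_eq)
  also have "\<dots> = (\<Sum>g\<in>I. count A g)"
    using assms by (intro sum.mono_neutral_left) (auto simp: not_in_iff)
  also have "\<dots> = count A 0 + (\<Sum>g\<in>J. count A g)"
    unfolding I_eq by (subst sum.insert) auto
  finally show ?thesis .
qed

text \<open>Rankin's trick: weight every element by \<open>z\<close> and divide by z^p; the sum then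
  extends to all count vectors up to \<open>T\<close> and factorises. The fixed count
  \<open>t\<close> of 0 lets \<open>A\<close> be recovered from its counts on
  \<open>J\<close>.\<close>

lemma family_bound:
  assumes fin: "finite C" and z: "0 < z" "z * real T \<le> 1" and T: "T \<ge> 1"
    and C: "\<And>A. A \<in> C \<Longrightarrow> set_mset A \<subseteq> I \<and> count A 0 = t \<and> (\<Sum>g\<in>J. count A g) = p \<and> (\<forall>g\<in>J. count A g \<le> T)"
  shows "(\<Sum>A\<in>C. \<Prod>g\<in>J. wt (count A g)) \<le> (1 + 700 * z) ^ N / z ^ p"
proof -
  have inj: "inj_on (\<lambda>A. restrict (count A) J) C"
  proof (rule inj_onI)
    fix A B assume A: "A \<in> C" and B: "B \<in> C" and eq: "restrict (count A) J = restrict (count B) J"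
    show "A = B"
    proof (rule multiset_eqI)
      fix g
      consider "g = 0" | "g \<in> J" | "g \<notin> I" unfolding I_eq by blast
      then show "count A g = count B g"
      proof cases
        case 1
        then show ?thesis using C[OF A] C[OF B] by simp
      next
        case 2
        then show ?thesis using fun_cong[OF eq, of g] by simp
      next
        case 3
        then have "g \<notin># A" "g \<notin># B" using C[OF A] C[OF B] by blast+
        then show ?thesis by (simp add: not_in_iff)
      qed
    qed
  qed
  have "z ^ p * (\<Sum>A\<in>C. \<Prod>g\<in>J. wt (count A g)) = (\<Sum>A\<in>C. \<Prod>g\<in>J. wt (count A g) * z ^ count A g)"
    unfolding sum_distrib_left
    by (intro sum.cong refl) (use C in \<open>simp add: prod.distrib power_sum[symmetric]\<close>)
  also have "\<dots> = (\<Sum>A\<in>C. \<Prod>g\<in>J. wt (restrict (count A) J g) * z ^ restrict (count A) J g)"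
    by (intro sum.cong prod.cong refl) auto
  also have "\<dots> = (\<Sum>k\<in>(\<lambda>A. restrict (count A) J) ` C. \<Prod>g\<in>J. wt (k g) * z ^ k g)"
    by (subst sum.reindex[OF inj]) simp
  also have "\<dots> \<le> (\<Sum>k\<in>J \<rightarrow>\<^sub>E {..T}. \<Prod>g\<in>J. wt (k g) * z ^ k g)"
  proof (rule sum_mono2)
    show "finite (J \<rightarrow>\<^sub>E {..T})" by (intro finite_PiE) auto
    show "(\<lambda>A. restrict (count A) J) ` C \<subseteq> J \<rightarrow>\<^sub>E {..T}"
      using C by (intro image_subsetI restrict_PiE_iff[THEN iffD2]) blast
    show "0 \<le> (\<Prod>g\<in>J. wt (k g) * z ^ k g)" for k
      using z wt_pos by (intro prod_nonneg ballI mult_nonneg_nonneg) (auto simp: less_imp_le)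
  qed
  also have "\<dots> = (\<Prod>g\<in>J. \<Sum>c\<le>T. wt c * z ^ c)"
    by (rule prod_sum_PiE[symmetric]) auto
  also have "\<dots> = (\<Sum>c\<le>T. wt c * z ^ c) ^ card J" by simp
  also have "\<dots> \<le> (1 + 700 * z) ^ card J"
    using z wt_pos by (intro power_mono wt_gen_le T sum_nonneg mult_nonneg_nonneg) (auto simp: less_imp_le)
  also have "\<dots> \<le> (1 + 700 * z) ^ N"
    using z by (intro power_increasing) auto
  finally show ?thesis using z by (simp add: field_simps)
qed

definition level :: "nat \<Rightarrow> nat multiset set" where
  "level w = {A \<in> \<A>. count A 0 = N - w}"

text \<open>The two bounds on the multiplicities are the possible cutoffs: \<open>w\<close> because
  the counts on \<open>J\<close> sum to \<open>w\<close>, and \<open>N - w\<close> because 0 is the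
  most frequent value.\<close>

lemma levelD:
  assumes "A \<in> level w" "w \<le> N"
  shows "set_mset A \<subseteq> I" "count A 0 = N - w" "(\<Sum>g\<in>J. count A g) = w" "size A = N"
    "g \<in> J \<Longrightarrow> count A g \<le> w" "g \<in> J \<Longrightarrow> count A g \<le> N - w"
    "y \<in> I \<Longrightarrow> (\<Prod>g\<in>I. chi g y ^ count A g) = 1"
proof -
  show I: "set_mset A \<subseteq> I" and c: "count A 0 = N - w" and s: "size A = N"
    and "y \<in> I \<Longrightarrow> (\<Prod>g\<in>I. chi g y ^ count A g) = 1"
    using assms by (auto simp: level_def \<A>_def)
  show sw: "(\<Sum>g\<in>J. count A g) = w"
    using size_eq_count_sum[OF I] s c assms(2) by linarith
  show "g \<in> J \<Longrightarrow> count A g \<le> w"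
    using member_le_sum[of g J "count A"] sw by simp
  show "g \<in> J \<Longrightarrow> count A g \<le> N - w"
    using assms(1) I_eq c by (auto simp: level_def \<A>_def)
qed

lemma finite_level: "finite (level w)"
  unfolding level_def using finite_A by simp

text \<open>Since the product of all characters in \<open>A\<close> is trivial, \<open>A\<close> can be recovered after the
  deletion of one nonzero element; this gains a factor \<open>N\<close> over counting all multisets.\<close>

lemma level_delete:
  assumes w: "1 \<le> w" "w \<le> N" and z: "0 < z" "z * real w \<le> 1"
  shows "(\<Sum>A\<in>level w. \<Prod>g\<in>J. wt (count A g)) \<le> 8 * real w * ((1 + 700 * z) ^ N / z ^ (w - 1))"
proof -
  define pick where "pick A = (SOME g. g \<in> J \<and> g \<in># A)" for A :: "nat multiset"
  define D where "D A = A - {#pick A#}" for A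
  have pick: "pick A \<in> J" "pick A \<in># A" if A: "A \<in> level w" for A
  proof -
    have "\<exists>g. g \<in> J \<and> g \<in># A"
    proof (rule ccontr)
      assume "\<not> ?thesis"
      then have "(\<Sum>g\<in>J. count A g) = 0" by (intro sum.neutral) (auto simp: not_in_iff)
      then show False using levelD(3)[OF A w(2)] w by simp
    qed
    from someI_ex[OF this] show "pick A \<in> J" "pick A \<in># A" unfolding pick_def by auto
  qed
  have add: "A = add_mset (pick A) (D A)" if "A \<in> level w" for A
    using pick(2)[OF that] by (simp add: D_def)
  have inj: "inj_on D (level w)"
  proof (rule inj_onI)
    fix A B assume A: "A \<in> level w" and B: "B \<in> level w" and eq: "D A = D B"
    \<comment> \<open>Characters square to 1, so the triviality of the full product expresses the
      character of the deleted element through \<open>D A\<close>.\<close>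
    have val: "(\<Prod>g\<in>I. chi g y ^ count (D A) g) = chi (pick A) y" if y: "y \<in> I" and A: "A \<in> level w" for A y
    proof -
      have "1 = (\<Prod>g\<in>I. chi g y ^ count (add_mset (pick A) (D A)) g)"
        using levelD(7)[OF A w(2) y] add[OF A] by simp
      also have "\<dots> = (\<Prod>g\<in>I. (if g = pick A then chi g y else 1) * chi g y ^ count (D A) g)"
        by (intro prod.cong refl) auto
      also have "\<dots> = chi (pick A) y * (\<Prod>g\<in>I. chi g y ^ count (D A) g)"
        using pick(1)[OF A] by (simp add: prod.distrib prod.delta)
      finally have "chi (pick A) y * 1 = chi (pick A) y * (chi (pick A) y * (\<Prod>g\<in>I. chi g y ^ count (D A) g))"
        by simp
      then show ?thesis by (simp add: mult.assoc[symmetric])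
    qed
    have "pick A = pick B"
    proof (rule chi_eqI)
      show "pick A \<in> I" "pick B \<in> I" using pick(1)[OF A] pick(1)[OF B] by auto
      fix y assume "y \<in> I"
      then show "chi (pick A) y = chi (pick B) y"
        using val[of y A] val[of y B] A B eq by simp
    qed
    then show "A = B" using add[OF A] add[OF B] eq by metis
  qed
  have "(\<Sum>A\<in>level w. \<Prod>g\<in>J. wt (count A g)) \<le> (\<Sum>A\<in>level w. 8 * real w * (\<Prod>g\<in>J. wt (count (D A) g)))"
  proof (rule sum_mono)
    fix A assume A: "A \<in> level w"
    let ?g = "pick A"
    have c: "count A ?g = Suc (count (D A) ?g)" by (subst add[OF A]) simp
    have cg: "count A g = count (D A) g" if "g \<noteq> ?g" for g by (subst add[OF A]) (use that in simp)
    \<comment> \<open>The deleted element had multiplicity at most \<open>w\<close>, hence the loss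
      8 w.\<close>
    have "wt (count A ?g) \<le> 8 * real (Suc (count (D A) ?g)) * wt (count (D A) ?g)"
      unfolding c by (rule wt_Suc_le)
    also have "\<dots> \<le> 8 * real w * wt (count (D A) ?g)"
      using levelD(5)[OF A w(2) pick(1)[OF A]] wt_pos c by (intro mult_right_mono) (auto simp: less_imp_le)
    finally have wc: "wt (count A ?g) \<le> 8 * real w * wt (count (D A) ?g)" .
    have "(\<Prod>g\<in>J. wt (count A g)) = wt (count A ?g) * (\<Prod>g\<in>J - {?g}. wt (count A g))"
      using pick(1)[OF A] by (intro prod.remove) auto
    also have "(\<Prod>g\<in>J - {?g}. wt (count A g)) = (\<Prod>g\<in>J - {?g}. wt (count (D A) g))"
      by (intro prod.cong refl) (use cg in auto)
    also have "wt (count A ?g) * (\<Prod>g\<in>J - {?g}. wt (count (D A) g))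
        \<le> 8 * real w * wt (count (D A) ?g) * (\<Prod>g\<in>J - {?g}. wt (count (D A) g))"
      using wc wt_pos by (intro mult_right_mono prod_nonneg) (auto simp: less_imp_le)
    also have "\<dots> = 8 * real w * (\<Prod>g\<in>J. wt (count (D A) g))"
    proof -
      have "(\<Prod>g\<in>J. wt (count (D A) g)) = wt (count (D A) ?g) * (\<Prod>g\<in>J - {?g}. wt (count (D A) g))"
        using pick(1)[OF A] by (intro prod.remove) auto
      then show ?thesis by (simp only: mult.assoc)
    qed
    finally show "(\<Prod>g\<in>J. wt (count A g)) \<le> 8 * real w * (\<Prod>g\<in>J. wt (count (D A) g))" .
  qed
  also have "\<dots> = 8 * real w * (\<Sum>B\<in>D ` level w. \<Prod>g\<in>J. wt (count B g))"
    by (subst sum.reindex[OF inj]) (simp add: sum_distrib_left)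
  also have "\<dots> \<le> 8 * real w * ((1 + 700 * z) ^ N / z ^ (w - 1))"
  proof (intro mult_left_mono family_bound[where T = w and t = "N - w"])
    fix B assume "B \<in> D ` level w"
    then obtain A where A: "A \<in> level w" and B: "B = D A" by blast
    have sub: "set_mset B \<subseteq> set_mset A" unfolding B D_def by (meson in_diffD subsetI)
    have c0: "count B 0 = count A 0"
      using pick(1)[OF A] unfolding B by (subst (2) add[OF A]) auto
    have "size A = Suc (size B)" using arg_cong[OF add[OF A], of size] B by simp
    then have "(\<Sum>g\<in>J. count B g) = w - 1"
    proof -
      have "set_mset B \<subseteq> I" using sub levelD(1)[OF A w(2)] by blast
      then show ?thesis
        using size_eq_count_sum[of B] levelD(2,4)[OF A w(2)] c0 w \<open>size A = Suc (size B)\<close> by linarith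
    qed
    moreover have "count B g \<le> w" if "g \<in> J" for g
      using levelD(5)[OF A w(2) that] unfolding B D_def by simp
    ultimately show "set_mset B \<subseteq> I \<and> count B 0 = N - w \<and> (\<Sum>g\<in>J. count B g) = w - 1 \<and> (\<forall>g\<in>J. count B g \<le> w)"
      using sub levelD[OF A w(2)] c0 by auto
  qed (use w z finite_level in auto)
  finally show ?thesis .
qed

text \<open>The ratio phi(N - w) / phi(N) contributes exp(3w) and the nonzero elements contribute
  exp(-2w), which leaves exp w.\<close>

lemma level_phi_le:
  assumes w: "w \<le> N"
  shows "(\<Sum>A\<in>level w. (\<Prod>g\<in>I. phi (count A g)) / phi N)
    \<le> exp (real w) * real (N - w) ^ (N - w) / real N ^ N * (\<Sum>A\<in>level w. \<Prod>g\<in>J. wt (count A g))"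
proof -
  let ?c = "exp (real w) * real (N - w) ^ (N - w) / real N ^ N"
  have ratio: "phi (N - w) / phi N \<le> exp (3 * real w) * real (N - w) ^ (N - w) / real N ^ N"
    using phi_ratio_le[of "N - w" N] w by (simp add: of_nat_diff)
  show ?thesis unfolding sum_distrib_left
  proof (rule sum_mono)
    fix A assume A: "A \<in> level w"
    have "(\<Prod>g\<in>I. phi (count A g)) = phi (N - w) * (\<Prod>g\<in>J. phi (count A g))"
      unfolding I_eq by (subst prod.insert) (auto simp: levelD(2)[OF A w])
    then have "(\<Prod>g\<in>I. phi (count A g)) / phi N = phi (N - w) / phi N * (\<Prod>g\<in>J. phi (count A g))"
      by simp
    also have "\<dots> \<le> (exp (3 * real w) * real (N - w) ^ (N - w) / real N ^ N) * (\<Prod>g\<in>J. wt (count A g) * exp (- 2 * real (count A g)))"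
      using phi_pos phi_le_wt
      by (intro mult_mono ratio prod_mono prod_nonneg) (auto simp: less_imp_le)
    also have "(\<Prod>g\<in>J. wt (count A g) * exp (- 2 * real (count A g))) = (\<Prod>g\<in>J. wt (count A g)) * exp (- 2 * real w)"
      using levelD(3)[OF A w] by (simp add: prod.distrib exp_sum[symmetric] sum_negf sum_distrib_left[symmetric] of_nat_sum[symmetric] del: of_nat_sum)
    also have "exp (3 * real w) * real (N - w) ^ (N - w) / real N ^ N * ((\<Prod>g\<in>J. wt (count A g)) * exp (- 2 * real w))
        = (exp (3 * real w) * exp (- 2 * real w)) * real (N - w) ^ (N - w) / real N ^ N * (\<Prod>g\<in>J. wt (count A g))"
      by simp
    also have "exp (3 * real w) * exp (- 2 * real w) = exp (real w)"
      by (simp add: exp_add[symmetric])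
    finally show "(\<Prod>g\<in>I. phi (count A g)) / phi N \<le> ?c * (\<Prod>g\<in>J. wt (count A g))" .
  qed
qed

text \<open>The first summand covers the small range of \<open>w\<close>. In the other two ranges
  exponential decay makes a level O(1/N^2), so that fewer than \<open>N\<close> levels still add up
  to O(1/N).\<close>

lemma level_le:
  assumes N: "7000 \<le> N" and w: "1 \<le> w" "w < N" and K: "\<And>n. real n ^ 4 * 0.95 ^ n \<le> K"
  shows "(\<Sum>A\<in>level w. (\<Prod>g\<in>I. phi (count A g)) / phi N)
    \<le> 8 * (40000 * exp 2) ^ w / fact w / real N + exp 700 * K / (real N)\<^sup>2"
proof -
  let ?c = "exp (real w) * real (N - w) ^ (N - w) / real N ^ N"
  let ?Q = "\<Sum>A\<in>level w. \<Prod>g\<in>J. wt (count A g)"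
  let ?a = "8 * (40000 * exp 2) ^ w / fact w / real N"
  have K0: "K \<ge> 0" using K[of 0] by simp
  have c0: "?c \<ge> 0" by simp
  have n0: "real N > 0" by simp
  have wN: "w \<le> N" using w by simp
  have a0: "0 \<le> ?a" by simp
  have b0: "0 \<le> exp 700 * K / (real N)\<^sup>2" using K0 by simp
  \<comment> \<open>Applied with k = w in the medium range and with k = N in the large one; N <= k^2
    is the reason for the fourth power in the bound \<open>K\<close>.\<close>
  have decay: "0.95 ^ k \<le> K / (real N)\<^sup>2" if k: "real N \<le> (real k)\<^sup>2" "k > 0" for k
  proof -
    have "(real N)\<^sup>2 \<le> ((real k)\<^sup>2)\<^sup>2" using k by (intro power_mono) auto
    then have "0.95 ^ k * (real N)\<^sup>2 \<le> 0.95 ^ k * real k ^ 4"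
      by (intro mult_left_mono) (auto simp: power_mult[symmetric])
    also have "\<dots> \<le> K" using K[of k] by (simp add: mult.commute)
    finally show ?thesis using n0 by (simp add: field_simps)
  qed
  have e700: "K / (real N)\<^sup>2 \<le> exp 700 * K / (real N)\<^sup>2"
  proof -
    have "1 * K \<le> exp 700 * K" using K0 by (intro mult_right_mono) auto
    then show ?thesis by (intro divide_right_mono) auto
  qed
  have "?c * ?Q \<le> ?a + exp 700 * K / (real N)\<^sup>2"
  proof (cases "real w ^ 2 \<le> 10000 * real N")
    case True
    define z where "z = real w / (10000 * real N)"
    have z: "0 < z" "z * real w \<le> 1"
      using w n0 True by (auto simp: z_def power2_eq_square field_simps)
    have "?c * ?Q \<le> ?c * (8 * real w * ((1 + 700 * z) ^ N / z ^ (w - 1)))"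
      by (intro mult_left_mono level_delete w wN z c0)
    also have "\<dots> \<le> ?a"
      using small_regime[OF w(1) wN True] by (simp add: z_def)
    finally show ?thesis using b0 by linarith
  next
    case False
    then have big: "10000 * real N \<le> (real w)\<^sup>2" by simp
    show ?thesis
    proof (cases "2 * w \<le> N")
      case True
      \<comment> \<open>The level itself is bounded here, with the full exponent \<open>w\<close>;
        the decay 0.95^w outweighs the factor \<open>N\<close> that deletion would gain.\<close>
      have "?c * ?Q \<le> ?c * ((1 + 700 * (1 / real w)) ^ N / (1 / real w) ^ w)"
        using w levelD wN by (intro mult_left_mono family_bound[where T = w and t = "N - w"] c0 finite_level) auto
      also have "\<dots> \<le> 0.95 ^ w"
        by (rule medium_regime[OF w(1) True big])
      also have "\<dots> \<le> K / (real N)\<^sup>2"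
      proof (rule decay)
        show "real N \<le> (real w)\<^sup>2" using big n0 by linarith
      qed (use w in simp)
      finally show ?thesis using e700 a0 by linarith
    next
      case False
      define t where "t = N - w"
      have t: "1 \<le> t" "2 * t \<le> N" "N - t = w" using False w by (auto simp: t_def)
      have "?c * ?Q \<le> ?c * ((1 + 700 * (1 / real t)) ^ N / (1 / real t) ^ w)"
        using t levelD wN by (intro mult_left_mono family_bound[where T = t and t = "N - w"] c0 finite_level) (auto simp: t_def)
      also have "\<dots> \<le> exp 700 * 0.95 ^ N"
        using large_regime[OF t(1,2) N] unfolding t(3) by (simp add: t_def)
      also have "\<dots> \<le> exp 700 * (K / (real N)\<^sup>2)"
        using N by (intro mult_left_mono decay) (auto simp: power2_eq_square)
      also have "\<dots> = exp 700 * K / (real N)\<^sup>2" by simp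
      finally show ?thesis using a0 by linarith
    qed
  qed
  then show ?thesis using level_phi_le[OF wN] by linarith
qed

lemma L_pred_bound:
  assumes N: "7000 \<le> N" and K: "\<And>n. real n ^ 4 * 0.95 ^ n \<le> K"
  shows "L {..<N - 1} \<le> (8 * exp (40000 * exp 2) + exp 700 * K) / real N"
proof -
  have K0: "K \<ge> 0" using K[of 0] by simp
  have "L {..<N - 1} \<le> (\<Sum>A\<in>\<A>. \<Sum>b\<in>orbit A. hat b ^ 4)" by (rule L_pred_le)
  also have "\<dots> \<le> (\<Sum>A\<in>\<A>. (\<Prod>g\<in>I. phi (count A g)) / phi N)"
    by (intro sum_mono orbit_sum_le) (auto simp: \<A>_def)
  also have "\<dots> = (\<Sum>w\<in>{1..<N}. \<Sum>A | A \<in> \<A> \<and> N - count A 0 = w. (\<Prod>g\<in>I. phi (count A g)) / phi N)"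
  proof (rule sum.group[symmetric])
    show "(\<lambda>A. N - count A 0) ` \<A> \<subseteq> {1..<N}"
    proof (intro image_subsetI)
      fix A assume A: "A \<in> \<A>"
      then have "count A 0 \<le> N" "count A 0 \<noteq> N" using count_le_size[of A 0] by (auto simp: \<A>_def)
      moreover have "count A 0 > 0"
      proof (rule ccontr)
        assume "\<not> count A 0 > 0"
        then have c0: "count A 0 = 0" by (simp only: not_gr_zero)
        have "\<forall>g\<in>I. count A g \<le> count A 0" using A unfolding \<A>_def by blast
        then have "count A g = 0" if "g \<in> I" for g using that unfolding c0 by blast
        then have "size A = 0" using A size_eq_count_sum[of A] by (auto simp: \<A>_def I_eq)
        then show False using A by (simp add: \<A>_def)
      qed
      ultimately show "N - count A 0 \<in> {1..<N}" by auto
    qed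
  qed (auto simp: finite_A)
  also have "\<dots> = (\<Sum>w\<in>{1..<N}. \<Sum>A\<in>level w. (\<Prod>g\<in>I. phi (count A g)) / phi N)"
  proof (intro sum.cong refl)
    fix w assume w: "w \<in> {1..<N}"
    have "N - count A 0 = w \<longleftrightarrow> count A 0 = N - w" if "A \<in> \<A>" for A
    proof -
      have "size A = N" using that by (simp add: \<A>_def)
      then have "count A 0 \<le> N" "w \<le> N" using count_le_size[of A 0] w by auto
      then show ?thesis by linarith
    qed
    then show "{A. A \<in> \<A> \<and> N - count A 0 = w} = level w"
      unfolding level_def by blast
  qed
  also have "\<dots> \<le> (\<Sum>w\<in>{1..<N}. 8 / real N * ((40000 * exp 2) ^ w / fact w) + exp 700 * K / (real N)\<^sup>2)"
    using level_le[OF N _ _ K] by (intro sum_mono) (auto simp: mult_ac)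
  also have "\<dots> = 8 / real N * (\<Sum>w\<in>{1..<N}. (40000 * exp 2) ^ w / fact w) + real (N - 1) * (exp 700 * K / (real N)\<^sup>2)"
    by (simp add: sum.distrib sum_distrib_left)
  \<comment> \<open>The exponential series bounds the sum over \<open>w\<close> independently of
    \<open>N\<close>; this is where the 1/w! of the small range is spent.\<close>
  also have "\<dots> \<le> 8 / real N * exp (40000 * exp 2) + real N * (exp 700 * K / (real N)\<^sup>2)"
    using K0 by (intro add_mono mult_left_mono mult_right_mono sum_power_fact_le_exp) auto
  also have "\<dots> = (8 * exp (40000 * exp 2) + exp 700 * K) / real N"
    by (simp add: field_simps power2_eq_square)
  finally show ?thesis .
qed

end

theorem theorem8p1:
  shows "\<exists>C::real. \<forall>k d (E :: nat \<Rightarrow> nat \<Rightarrow> nat) (m::nat).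
     is_prp_gen k d E \<longrightarrow> m < 2 ^ d \<longrightarrow>
     adv_prf_xor k d E m \<le> 2 * adv_prp k d E m + C * real m / 2 powr (3 * real d / 2)"
proof -
  obtain K :: real where K0: "K > 0" and K: "\<And>n. real n ^ 4 * 0.95 ^ n \<le> K"
    using power_4_geometric_bounded by blast
  define B where "B = 8 * exp (40000 * exp 2) + exp 700 * K"
  \<comment> \<open>The first entry comes from sqrt(4 m^2/N^2 * B/N) when N >= 7000. The second
    makes the claimed error at least 1 for smaller \<open>N\<close> and m >= 1, where the advantage
    is trivially at most 1.\<close>
  define C where "C = max (2 * sqrt B) (7000 * sqrt 7000)"
  have "adv_prf_xor k d E m \<le> 2 * adv_prp k d E m + C * real m / 2 powr (3 * real d / 2)"
    if m: "m < 2 ^ d" for k d m and E :: "nat \<Rightarrow> nat \<Rightarrow> nat"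
  proof -
    interpret xor_group d .
    have B0: "B \<ge> 0" using K0 by (simp add: B_def)
    have powr: "2 powr (3 * real d / 2) = real N * sqrt (real N)"
    proof -
      have "(2 :: real) powr (3 * real d / 2) = 2 powr (real d + real d * (1 / 2))"
        by (rule arg_cong[of _ _ "\<lambda>x. 2 powr x"]) simp
      also have "\<dots> = 2 powr real d * (2 powr real d) powr (1 / 2)" unfolding powr_add powr_powr ..
      also have "\<dots> = real N * sqrt (real N)" by (subst powr_half_sqrt) (simp_all add: powr_realpow)
      finally show ?thesis .
    qed
    let ?X = "adv d m (xor_pmf (rand_perm d) (rand_perm d)) (rand_fun d)"
    have "?X \<le> C * real m / (real N * sqrt (real N))"
    proof (cases "N \<ge> 7000")
      case True
      have "?X \<le> sqrt (L {..<m})" using m by (intro adv_xor_perm_le) simp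
      also have "L {..<m} \<le> 4 * (real m)\<^sup>2 / (real N)\<^sup>2 * L {..<N - 1}"
        using m True by (intro L_le_L_pred) auto
      also have "\<dots> \<le> 4 * (real m)\<^sup>2 / (real N)\<^sup>2 * (B / real N)"
        using L_pred_bound[OF True K] unfolding B_def by (intro mult_left_mono) auto
      also have "sqrt (4 * (real m)\<^sup>2 / (real N)\<^sup>2 * (B / real N)) = 2 * sqrt B * real m / (real N * sqrt (real N))"
        by (simp add: real_sqrt_mult real_sqrt_divide)
      also have "\<dots> \<le> C * real m / (real N * sqrt (real N))"
        unfolding C_def by (intro divide_right_mono mult_right_mono) auto
      finally show ?thesis by simp
    next
      case False
      show ?thesis
      \<comment> \<open>Without queries the error term is 0 and the trivial bound 1 does not help,
        so the vanishing of \<open>L\<close> on the empty set is used.\<close>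
      proof (cases "m = 0")
        case True
        have "?X \<le> sqrt (L {..<m})" using m by (intro adv_xor_perm_le) simp
        then show ?thesis using True L_small[of 0] by simp
      next
        case m0: False
        have C0: "0 \<le> C" by (simp add: C_def le_max_iff_disj)
        have "N \<le> 7000" using False by linarith
        from of_nat_mono[OF this, where 'a = real] have "real N \<le> 7000" by simp
        then have "real N * sqrt (real N) \<le> 7000 * sqrt 7000" by (intro mult_mono) auto
        also have "\<dots> \<le> C * 1" by (simp add: C_def)
        also have "\<dots> \<le> C * real m" using m0 C0 by (intro mult_left_mono) auto
        finally have "1 \<le> C * real m / (real N * sqrt (real N))" by (simp add: field_simps)
        then show ?thesis using adv_le_1[of d m "xor_pmf (rand_perm d) (rand_perm d)" "rand_fun d"] by linarith
      qed
    qed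
    then show ?thesis using adv_prf_xor_le_hybrid[of k d E m] unfolding powr by linarith
  qed
  then show ?thesis by blast
qed

end
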